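(* Let $\mathbf V_0^D$ be a real diagonal $n\times n$ matrix, $E\in\mathbb R$, and let $\mathbf\Psi^D(x_i)$ be a given real symmetric $n\times n$ matrix. For $x$ in the interval with endpoints $x_i$ and $x_f$ (either $x_f>x_i$ or $x_f<x_i$), with $\delta=x-x_i$, let $$\mathbf\Psi^D(x)=[\delta\boldsymbol\eta_0+\boldsymbol\xi\,\mathbf\Psi^D(x_i)]\,[\boldsymbol\xi+(\mathbf Z/\delta)\boldsymbol\eta_0\mathbf\Psi^D(x_i)]^{-1},\qquad \mathbf\Omega(x)=[\boldsymbol\xi-\delta\boldsymbol\eta_0\mathbf\Psi^D(x_i)]^{-1}[\boldsymbol\xi\,\mathbf\Psi^D(x_i)+\delta\boldsymbol\eta_0],$$ with $\boldsymbol\xi,\boldsymbol\eta_0,\mathbf Z$ as in the context. Let the eigenvalues (with multiplicity) of $\mathbf\Psi^D(x)$ be represented as $\tan\rho_j$ and the eigenvalues of $\mathbf\Omega(x)$ as $\tan\tau_j$, $j=1,\dots,n$, where $0\le\rho_j<\pi$ and $0\le\tau_j<\pi$. Then $$S(\mathbf\Psi^D(x))=S(\mathbf\Psi^D(x_i))+S(\delta\boldsymbol\xi^{-1}\boldsymbol\eta_0)+\sum_{j=1}^n(\rho_j-\tau_j),$$ where the quantities $S(\cdot)$ (sums of continuously followed phase angles) are defined in the context.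
   Context: Functions: $\xi(z)=\cos(|z|^{1/2})$ for $z\le 0$ and $\cosh(z^{1/2})$ for $z>0$; $\eta_0(z)=\sin(|z|^{1/2})/|z|^{1/2}$ for $z<0$, $\eta_0(0)=1$, $\eta_0(z)=\sinh(z^{1/2})/z^{1/2}$ for $z>0$. $\mathbf Z=\mathbf Z(\delta)=(\mathbf V_0^D-E\mathbf I)\delta^2$ is diagonal with diagonal entries $Z_k(\delta)$, and $\boldsymbol\xi=\boldsymbol\xi(\mathbf Z(\delta))$, $\boldsymbol\eta_0=\boldsymbol\eta_0(\mathbf Z(\delta))$ are the diagonal matrices with diagonal entries $\xi(Z_k(\delta))$, $\eta_0(Z_k(\delta))$. $\mathbf Z/\delta$ means $(\mathbf V_0^D-E\mathbf I)\delta$. Thus $\mathbf\Psi^D(x)=\mathbf Y(x)\mathbf Y'(x)^{-1}$, where $\mathbf Y$ is the $n\times n$ matrix solution of $\mathbf Y''=(\mathbf V_0^D-E\mathbf I)\mathbf Y$ with $\mathbf Y(x_i)=\mathbf\Psi^D(x_i)$, $\mathbf Y'(x_i)=\mathbf I$. (This is the propagation of $\mathbf\Psi=\mathbf Y(\mathbf Y')^{-1}$ over a mesh interval on which the potential matrix is constant, after diagonalization of that constant matrix.) Sums of phase angles: let $\phi_1(x),\dots,\phi_n(x)$ be continuous functions of $x$ on the interval with endpoints $x_i,x_f$ such that the eigenvalues (with multiplicity) of $\mathbf\Psi^D(x)$ are $\tan\phi_j(x)$ (any fixed choice of the values at $x_i$), and put $S(\mathbf\Psi^D(x))=\sum_{j=1}^n\phi_j(x)$.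 Further, $S(\delta\boldsymbol\xi^{-1}\boldsymbol\eta_0)=\sum_{j=1}^n\theta_j(x_i+\delta)$, where $\theta_j$ is the solution of $$\theta_j'=\cos^2\theta_j+d_j\sin^2\theta_j,\qquad\theta_j(x_i)=0,$$ with $d_j$ the $j$-th diagonal entry of $E\mathbf I-\mathbf V_0^D$; equivalently $\theta_j$ is the continuous Prüfer angle, $\tan\theta_j=y_j/y_j'$, of the solution of $y_j''+d_jy_j=0$, $y_j(x_i)=0$, $y_j'(x_i)=1$, so that $\tan\theta_j(x_i+\delta)=\delta\,\eta_0(-d_j\delta^2)/\xi(-d_j\delta^2)$. Convention when an inverse does not exist (the value $\tan=\infty$ corresponds to the angle $\pi/2$ modulo $\pi$): in all cases the $\phi_j(x)$ (and $\rho_j$) are, modulo $\pi$ and with multiplicity, the roots $\phi$ of $\det(\cos\phi\,\mathbf N-\sin\phi\,\mathbf M)=0$ with $\mathbf N=\delta\boldsymbol\eta_0+\boldsymbol\xi\mathbf\Psi^D(x_i)$, $\mathbf M=\boldsymbol\xi+(\mathbf Z/\delta)\boldsymbol\eta_0\mathbf\Psi^D(x_i)$, and the $\tau_j$ are, with multiplicity, the roots $\tau\in[0,\pi)$ of $\det(\cos\tau\,\mathbf N-\sin\tau\,[\boldsymbol\xi-\delta\boldsymbol\eta_0\mathbf\Psi^D(x_i)])=0$; this agrees with the definitions above whenever the inverses exist. *)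

theory Defs
  imports "HOL-Complex_Analysis.Complex_Analysis" "HOL-Computational_Algebra.Polynomial"
begin

section \<open>The functions and matrices of the propagation formula\<close>

definition xi_fun :: "real \<Rightarrow> real" where
  "xi_fun z = (if z \<le> 0 then cos (sqrt \<bar>z\<bar>) else cosh (sqrt z))"

definition eta0_fun :: "real \<Rightarrow> real" where
  "eta0_fun z =
     (if z < 0 then sin (sqrt \<bar>z\<bar>) / sqrt \<bar>z\<bar>
      else if z = 0 then 1
      else sinh (sqrt z) / sqrt z)"

definition diag_mat :: "('n \<Rightarrow> real) \<Rightarrow> real^'n^'n" where
  "diag_mat d = (\<chi> i j. if i = j then d i else 0)"

definition Z_diag :: "real^'n^'n \<Rightarrow> real \<Rightarrow> real \<Rightarrow> 'n \<Rightarrow> real" where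
  "Z_diag V E \<delta> k = ((\<delta>\<^sup>2 *\<^sub>R (V - E *\<^sub>R mat 1)) $ k $ k)"

definition xi_mat :: "real^'n^'n \<Rightarrow> real \<Rightarrow> real \<Rightarrow> real^'n^'n" where
  "xi_mat V E \<delta> = diag_mat (\<lambda>k. xi_fun (Z_diag V E \<delta> k))"

definition eta0_mat :: "real^'n^'n \<Rightarrow> real \<Rightarrow> real \<Rightarrow> real^'n^'n" where
  "eta0_mat V E \<delta> = diag_mat (\<lambda>k. eta0_fun (Z_diag V E \<delta> k))"

text \<open>
  Below, \<open>V\<close> is the (diagonal) potential matrix, \<open>P\<close> is the initial value of \<open>\<Psi>\<close>,
  and \<open>\<delta>\<close> is the displacement from the initial point.  In \<open>Psi_den\<close> the
  matrix \<open>\<delta> *\<^sub>R (V - E *\<^sub>R mat 1)\<close> is what the formula writes as \<open>Z / \<delta>\<close>,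
  so that \<open>\<delta> = 0\<close> needs no special treatment.
\<close>

definition Psi_num :: "real^'n^'n \<Rightarrow> real \<Rightarrow> real^'n^'n \<Rightarrow> real \<Rightarrow> real^'n^'n" where
  "Psi_num V E P \<delta> = \<delta> *\<^sub>R eta0_mat V E \<delta> + xi_mat V E \<delta> ** P"

definition Psi_den :: "real^'n^'n \<Rightarrow> real \<Rightarrow> real^'n^'n \<Rightarrow> real \<Rightarrow> real^'n^'n" where
  "Psi_den V E P \<delta> =
     xi_mat V E \<delta> + (\<delta> *\<^sub>R (V - E *\<^sub>R mat 1)) ** eta0_mat V E \<delta> ** P"

definition Omega_den :: "real^'n^'n \<Rightarrow> real \<Rightarrow> real^'n^'n \<Rightarrow> real \<Rightarrow> real^'n^'n" where
  "Omega_den V E P \<delta> = xi_mat V E \<delta> - \<delta> *\<^sub>R eta0_mat V E \<delta> ** P"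

definition Psi :: "real^'n^'n \<Rightarrow> real \<Rightarrow> real^'n^'n \<Rightarrow> real \<Rightarrow> real^'n^'n" where
  "Psi V E P \<delta> = Psi_num V E P \<delta> ** matrix_inv (Psi_den V E P \<delta>)"

definition Omega :: "real^'n^'n \<Rightarrow> real \<Rightarrow> real^'n^'n \<Rightarrow> real \<Rightarrow> real^'n^'n" where
  "Omega V E P \<delta> = matrix_inv (Omega_den V E P \<delta>) ** Psi_num V E P \<delta>"


section \<open>Phase angles\<close>

text \<open>
  The function \<open>t \<mapsto> det (cos t N - sin t M)\<close>, extended to complex \<open>t\<close> so that
  the multiplicity of a root can be expressed by \<open>zorder\<close>.
\<close>

definition pencil_det :: "real^'n^'n \<Rightarrow> real^'n^'n \<Rightarrow> complex \<Rightarrow> complex" where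
  "pencil_det N M z =
     det (\<chi> i j. cos z * of_real (N $ i $ j) - sin z * of_real (M $ i $ j))"

text \<open>
  \<open>phase_angles N M \<phi>\<close>: the \<open>\<phi> j\<close> are, modulo \<open>\<pi>\<close> and with multiplicity, the roots of
  \<open>det (cos t N - sin t M) = 0\<close>.  If \<open>M\<close> is invertible this says that the eigenvalues
  of \<open>N M\<^sup>-\<^sup>1\<close>, equivalently those of \<open>M\<^sup>-\<^sup>1 N\<close>, counted with multiplicity, are the
  \<open>tan (\<phi> j)\<close>; see \<open>phase_angles_Psi\<close> and \<open>phase_angles_Omega\<close> below.
\<close>

definition phase_angles :: "real^'n^'n \<Rightarrow> real^'n^'n \<Rightarrow> ('n \<Rightarrow> real) \<Rightarrow> bool" where
  "phase_angles N M \<phi> \<longleftrightarrow>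
     (\<forall>t::real. int (card {j. \<exists>k::int. \<phi> j = t + of_int k * pi})
                  = zorder (pencil_det N M) (of_real t))"


section \<open>Agreement with the eigenvalues when the inverse exists\<close>

definition charpoly :: "real^'n^'n \<Rightarrow> real poly" where
  "charpoly A = det (\<chi> i j. (if i = j then [:0, 1:] else 0) - [:A $ i $ j:])"

definition eigenvalues_tan :: "real^'n^'n \<Rightarrow> ('n \<Rightarrow> real) \<Rightarrow> bool" where
  "eigenvalues_tan A \<phi> \<longleftrightarrow>
     (\<forall>j. cos (\<phi> j) \<noteq> 0) \<and> (\<forall>\<mu>. card {j. tan (\<phi> j) = \<mu>} = order \<mu> (charpoly A))"

definition cmat :: "real^'n^'n \<Rightarrow> complex^'n^'n" where
  "cmat A = (\<chi> i j. of_real (A $ i $ j))"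

lemma cmat_mult: "cmat (A ** B) = cmat A ** cmat B"
  by (simp add: cmat_def matrix_matrix_mult_def vec_eq_iff)

lemma det_cmat: "det (cmat A) = of_real (det A)"
  by (simp add: cmat_def det_def)

lemma det_scale: "det (\<chi> i j. c * B $ i $ j) = c ^ CARD('n) * det B"
  for B :: "'a::comm_ring_1^'n^'n"
  by (simp add: det_def sum_distrib_left prod.distrib mult_ac)

lemma pencil_det_mult_right:
  "pencil_det (A ** M) M z = pencil_det A (mat 1) z * of_real (det M)"
proof -
  have "(\<chi> i j. cos z * of_real ((A ** M) $ i $ j) - sin z * of_real (M $ i $ j))
      = (\<chi> i j. cos z * of_real (A $ i $ j) - sin z * of_real (mat 1 $ i $ j)) ** cmat M"
    by (simp add: vec_eq_iff matrix_matrix_mult_def cmat_def mat_def left_diff_distrib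
        sum_subtractf sum_distrib_left mult.assoc if_distrib[of of_real] if_distrib[of "(*) _"]
        if_distrib[of "\<lambda>x. x * _"] cong: if_cong)
  thus ?thesis
    by (simp add: pencil_det_def det_mul det_cmat)
qed

lemma pencil_det_mult_left:
  "pencil_det (M ** A) M z = of_real (det M) * pencil_det A (mat 1) z"
proof -
  have "(\<chi> i j. cos z * of_real ((M ** A) $ i $ j) - sin z * of_real (M $ i $ j))
      = cmat M ** (\<chi> i j. cos z * of_real (A $ i $ j) - sin z * of_real (mat 1 $ i $ j))"
    by (simp add: vec_eq_iff matrix_matrix_mult_def cmat_def mat_def right_diff_distrib
        sum_subtractf sum_distrib_left mult_ac if_distrib[of of_real] if_distrib[of "(*) _"]
        if_distribR cong: if_cong)
  thus ?thesis
    by (simp add: pencil_det_def det_mul det_cmat)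
qed

abbreviation cpoly :: "real poly \<Rightarrow> complex poly" where
  "cpoly \<equiv> map_poly of_real"

lemma cpoly_add: "cpoly (p + q) = cpoly p + cpoly q"
  by (intro poly_eqI) (simp add: coeff_map_poly)

lemma cpoly_mult: "cpoly (p * q) = cpoly p * cpoly q"
  by (intro poly_eqI) (simp add: coeff_map_poly coeff_mult)

lemma cpoly_sum: "cpoly (sum f A) = (\<Sum>x\<in>A. cpoly (f x))"
  by (induction A rule: infinite_finite_induct) (simp_all add: cpoly_add)

lemma cpoly_prod: "cpoly (prod f A) = (\<Prod>x\<in>A. cpoly (f x))"
  by (induction A rule: infinite_finite_induct) (simp_all add: cpoly_mult)

lemma cpoly_of_int: "cpoly (of_int k) = of_int k"
  by (intro poly_eqI) (simp add: coeff_map_poly of_int_poly coeff_pCons split: nat.splits)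

lemma poly_cpoly_of_real: "poly (cpoly p) (of_real x) = of_real (poly p x)"
  by (induction p) (simp_all add: map_poly_pCons)

lemma poly_cpoly_charpoly:
  "poly (cpoly (charpoly A)) x = det (\<chi> i j. (if i = j then x else 0) - of_real (A $ i $ j))"
proof -
  have "poly (cpoly ((if i = j then [:0, 1:] else 0) - [:a:])) x
          = (if i = j then x else 0) - of_real a" for i j :: 'a and a
    by (simp add: map_poly_pCons)
  thus ?thesis
    by (simp add: charpoly_def det_def cpoly_sum cpoly_mult cpoly_prod cpoly_of_int
        poly_sum poly_prod)
qed

lemma pencil_det_charpoly:
  fixes A :: "real^'n^'n"
  assumes "cos z \<noteq> 0"
  shows "pencil_det A (mat 1) z = (- cos z) ^ CARD('n) * poly (cpoly (charpoly A)) (tan z)"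
proof -
  have "pencil_det A (mat 1) z
      = det (\<chi> i j. (- cos z) * (\<chi> i j. (if i = j then tan z else 0) - of_real (A $ i $ j)) $ i $ j)"
    using assms unfolding pencil_det_def
    by (intro arg_cong[of _ _ det]) (simp add: vec_eq_iff mat_def tan_def right_diff_distrib)
  thus ?thesis
    by (simp only: det_scale poly_cpoly_charpoly)
qed

lemma isCont_pencil_det: "isCont (pencil_det N M) z"
  unfolding pencil_det_def det_def by (simp add: continuous_intros)

lemma pencil_det_analytic: "pencil_det N M analytic_on S"
  unfolding pencil_det_def det_def by (auto intro!: analytic_intros)

lemma charpoly_nonzero:
  fixes A :: "real^'n^'n"
  shows "charpoly A \<noteq> 0"
proof
  assume "charpoly A = 0"
  hence *: "pencil_det A (mat 1) z = 0" if "cos z \<noteq> 0" for z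
    using pencil_det_charpoly[OF that, of A] by simp
  let ?c = "of_real (pi / 2) :: complex"
  have "((\<lambda>w. (cos w - cos ?c) / (w - ?c)) \<longlongrightarrow> - sin ?c) (at ?c)"
    using DERIV_cos[of ?c] by (simp add: has_field_derivative_iff)
  moreover have "- sin ?c \<noteq> 0"
    by (simp add: sin_of_real del: of_real_divide)
  ultimately have "\<forall>\<^sub>F w in at ?c. (cos w - cos ?c) / (w - ?c) \<noteq> 0"
    by (rule tendsto_imp_eventually_ne)
  hence "\<forall>\<^sub>F w in at ?c. pencil_det A (mat 1) w = 0"
    by (rule eventually_mono) (auto simp: cos_of_real * simp del: of_real_divide)
  hence "(pencil_det A (mat 1) \<longlongrightarrow> 0) (at ?c)"
    by (rule tendsto_eventually)
  moreover have "(pencil_det A (mat 1) \<longlongrightarrow> pencil_det A (mat 1) ?c) (at ?c)"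
    using isCont_pencil_det by (simp add: isCont_def)
  ultimately have "pencil_det A (mat 1) ?c = 0"
    using tendsto_unique by (metis at_neq_bot)
  moreover have "pencil_det A (mat 1) ?c = det (\<chi> i j. (-1) * (mat 1 :: complex^'n^'n) $ i $ j)"
    unfolding pencil_det_def
    by (intro arg_cong[of _ _ det])
       (simp add: vec_eq_iff mat_def sin_of_real cos_of_real del: of_real_divide)
  ultimately show False
    by (simp only: det_scale) simp
qed

lemma zorder_pencil_charpoly:
  assumes D: "D \<noteq> 0" and f: "\<And>z. f z = of_real D * pencil_det A (mat 1) z"
    and t: "cos t \<noteq> 0"
  shows "zorder f (of_real t) = int (order (tan t) (charpoly A))"
proof -
  let ?t = "of_real t :: complex"
  let ?m = "order (tan t) (charpoly A)"
  let ?S = "{z :: complex. cos z \<noteq> 0}"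
  obtain q where q: "charpoly A = [:- tan t, 1:] ^ ?m * q" and "\<not> [:- tan t, 1:] dvd q"
    using order_decomp[OF charpoly_nonzero] by blast
  hence q0: "poly q (tan t) \<noteq> 0"
    by (simp add: poly_eq_0_iff_dvd)
  have ct: "cos ?t \<noteq> 0" and tt: "tan ?t = of_real (tan t)"
    using t by (simp_all add: cos_of_real sin_of_real tan_def)
  have S: "open ?S"
    by (rule open_Collect_neq) (auto intro!: continuous_intros)
  have tan: "tan holomorphic_on ?S"
    by (auto simp: holomorphic_on_def intro: field_differentiable_within_tan)
  define h where
    "h = (\<lambda>z. if z = ?t then deriv tan ?t else (tan z - tan ?t) / (z - ?t))"
  have h: "h holomorphic_on ?S"
    unfolding h_def by (rule pole_lemma_open[OF tan S])
  have h0: "h ?t \<noteq> 0"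
    using DERIV_imp_deriv[OF DERIV_tan[OF ct]] ct by (simp add: h_def)
  define g where
    "g = (\<lambda>z. of_real D * (- cos z) ^ CARD('a) * h z ^ ?m * poly (cpoly q) (tan z))"
  have cpow: "cpoly (p ^ k) = cpoly p ^ k" for p k
    by (induction k) (simp_all add: cpoly_mult)
  show ?thesis
  proof (rule zorder_eqI[OF S])
    show "g holomorphic_on ?S"
      unfolding g_def by (intro holomorphic_intros h tan)
    show "g ?t \<noteq> 0"
      using D ct h0 q0 by (simp add: g_def tt poly_cpoly_of_real)
    fix w :: complex
    assume w: "w \<in> ?S" "w \<noteq> ?t"
    have "tan w - of_real (tan t) = h w * (w - ?t)"
      using w by (simp add: h_def tt)
    moreover have "poly (cpoly (charpoly A)) (tan w)
        = (tan w - of_real (tan t)) ^ ?m * poly (cpoly q) (tan w)"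
      by (subst q) (simp add: cpoly_mult cpow map_poly_pCons)
    ultimately show "f w = g w * (w - ?t) powi int ?m"
      using w by (simp add: f pencil_det_charpoly g_def power_mult_distrib)
  qed (use ct in simp)
qed

lemma phase_angles_charpoly:
  fixes A :: "real^'n^'n"
  assumes D: "D \<noteq> 0" and f: "\<And>z. pencil_det N M z = of_real D * pencil_det A (mat 1) z"
  shows "phase_angles N M \<phi> \<longleftrightarrow> eigenvalues_tan A \<phi>"
proof -
  have tan_eq: "(\<exists>k::int. s = t + of_int k * pi) \<longleftrightarrow> tan s = tan t"
    if "cos s \<noteq> 0" "cos t \<noteq> 0" for s t :: real
  proof -
    have "tan s = tan t \<longleftrightarrow> sin (s - t) = 0"
      using that by (simp add: tan_def sin_diff frac_eq_eq mult.commute)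
    thus ?thesis
      by (simp add: sin_zero_iff_int2 algebra_simps)
  qed
  have cos_eq: "cos s = 0 \<longleftrightarrow> cos t = 0" if ex: "\<exists>k::int. s = t + of_int k * pi" for s t :: real
  proof -
    obtain k :: int where k: "s = t + of_int k * pi"
      using ex by blast
    have "sin (of_int k * pi) = 0"
      using sin_zero_iff_int2 by blast
    moreover from this have "cos (of_int k * pi) \<noteq> 0"
      using sin_cos_squared_add[of "of_int k * pi"] by auto
    ultimately show ?thesis
      by (simp add: k cos_add)
  qed
  have zero: "zorder (pencil_det N M) (of_real t) = 0" if "cos t = 0" for t
  proof (rule zorder_eq_0I[OF pencil_det_analytic])
    have "sin t \<noteq> 0"
      using that sin_cos_squared_add[of t] by auto
    have "pencil_det A (mat 1) (of_real t)
        = det (\<chi> i j. (- of_real (sin t)) * (mat 1 :: complex^'n^'n) $ i $ j)"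
      unfolding pencil_det_def
      by (intro arg_cong[of _ _ det]) (simp add: vec_eq_iff mat_def sin_of_real cos_of_real that)
    also have "\<dots> = (- of_real (sin t)) ^ CARD('n)"
      by (simp only: det_scale) simp
    finally show "pencil_det N M (of_real t) \<noteq> 0"
      using \<open>sin t \<noteq> 0\<close> D by (simp add: f)
  qed
  show ?thesis
  proof
    assume L: "phase_angles N M \<phi>"
    have cos: "cos (\<phi> j) \<noteq> 0" for j
    proof
      assume "cos (\<phi> j) = 0"
      from zero[OF this] L have "int (card {i. \<exists>k::int. \<phi> i = \<phi> j + of_int k * pi}) = 0"
        unfolding phase_angles_def by metis
      hence "card {i. \<exists>k::int. \<phi> i = \<phi> j + of_int k * pi} = 0"
        by linarith
      moreover have "j \<in> {i. \<exists>k::int. \<phi> i = \<phi> j + of_int k * pi}"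
        by (auto intro: exI[of _ 0])
      ultimately show False
        by (metis card_0_eq empty_iff finite)
    qed
    have "card {j. tan (\<phi> j) = \<mu>} = order \<mu> (charpoly A)" for \<mu>
    proof -
      have ct: "cos (arctan \<mu>) \<noteq> 0"
        by simp
      have "int (card {j. \<exists>k::int. \<phi> j = arctan \<mu> + of_int k * pi})
          = int (order \<mu> (charpoly A))"
        using L zorder_pencil_charpoly[OF D f ct] by (simp add: phase_angles_def tan_arctan)
      thus ?thesis
        by (simp add: tan_eq[OF cos ct] tan_arctan)
    qed
    with cos show "eigenvalues_tan A \<phi>"
      by (simp add: eigenvalues_tan_def)
  next
    assume R: "eigenvalues_tan A \<phi>"
    show "phase_angles N M \<phi>"
      unfolding phase_angles_def
    proof
      fix t :: real
      show "int (card {j. \<exists>k::int. \<phi> j = t + of_int k * pi}) = zorder (pencil_det N M) (of_real t)"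
      proof (cases "cos t = 0")
        case True
        hence "{j. \<exists>k::int. \<phi> j = t + of_int k * pi} = {}"
          using R cos_eq by (auto simp: eigenvalues_tan_def)
        thus ?thesis
          by (simp only: zero[OF True]) simp
      next
        case False
        have "{j. \<exists>k::int. \<phi> j = t + of_int k * pi} = {j. tan (\<phi> j) = tan t}"
          using R tan_eq[OF _ False] by (simp add: eigenvalues_tan_def)
        thus ?thesis
          using R zorder_pencil_charpoly[OF D f False] by (simp add: eigenvalues_tan_def)
      qed
    qed
  qed
qed

lemma phase_angles_Psi:
  assumes "invertible (Psi_den V E P \<delta>)"
  shows "phase_angles (Psi_num V E P \<delta>) (Psi_den V E P \<delta>) \<phi>
           \<longleftrightarrow> eigenvalues_tan (Psi V E P \<delta>) \<phi>"
proof -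
  let ?M = "Psi_den V E P \<delta>"
  have "matrix_inv ?M ** ?M = mat 1"
    using assms unfolding invertible_def matrix_inv_def by (rule someI2_ex) blast
  hence "Psi V E P \<delta> ** ?M = Psi_num V E P \<delta>"
    by (simp add: Psi_def flip: matrix_mul_assoc)
  thus ?thesis
    using assms pencil_det_mult_right[of "Psi V E P \<delta>" ?M]
    by (intro phase_angles_charpoly[of "det ?M"]) (simp_all add: invertible_det_nz)
qed

lemma phase_angles_Omega:
  assumes "invertible (Omega_den V E P \<delta>)"
  shows "phase_angles (Psi_num V E P \<delta>) (Omega_den V E P \<delta>) \<tau>
           \<longleftrightarrow> eigenvalues_tan (Omega V E P \<delta>) \<tau>"
proof -
  let ?M = "Omega_den V E P \<delta>"
  have "?M ** matrix_inv ?M = mat 1"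
    using assms unfolding invertible_def matrix_inv_def by (rule someI2_ex) blast
  hence "?M ** Omega V E P \<delta> = Psi_num V E P \<delta>"
    by (simp add: Omega_def matrix_mul_assoc)
  thus ?thesis
    using assms pencil_det_mult_left[of ?M "Omega V E P \<delta>"]
    by (intro phase_angles_charpoly[of "det ?M"]) (simp_all add: invertible_det_nz)
qed

end

theory Submission
  imports Defs "HOL-Computational_Algebra.Fundamental_Theorem_Algebra"
begin

text \<open>
  Write \<open>N\<close> for the common numerator and \<open>K\<close>, \<open>M\<close> for the denominators of \<open>\<Omega>\<close> and \<open>\<Psi>\<close>.
  A sum of phase angles is, modulo \<open>\<pi>\<close>, the argument of a determinant \<open>det (N - i M)\<close>, and
  \<open>N - i K = (\<xi> + i \<delta> \<eta>\<^sub>0) (P - i)\<close> accounts for the sum of the \<open>\<tau> j\<close>: the formula therefore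
  holds modulo \<open>\<pi>\<close>.  To remove the ambiguity, deform \<open>K\<close> into \<open>M\<close> along the segment
  \<open>M\<^sub>\<sigma> = (1 - \<sigma>) K + \<sigma> M\<close> with \<open>N\<close> fixed.  All these pencils are Lagrangian for a suitable
  weighted inner product, so \<open>det (N - i M\<^sub>\<sigma>)\<close> never vanishes and the angle \<open>0\<close> keeps the
  multiplicity \<open>dim (ker N)\<close>.  Hence \<open>\<Sum>j. \<rho> j - \<tau> j\<close> is the change of the continuous argument of
  \<open>det (N - i M\<^sub>\<sigma>)\<close> from \<open>\<sigma> = 0\<close> to \<open>\<sigma> = 1\<close>; this change is continuous in \<open>x\<close> and vanishes at
  the initial point.
\<close>

section \<open>Rigidity of continuous logarithms, and determinants\<close>

no_notation fps_nth (infixl \<open>$\<close> 75)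

text \<open>Values with the same exponential differ by multiples of 2 pi i, so \<open>h\<close> has
  a discrete range on a connected set. This lifts an identity modulo pi to one between continuously
  followed angles.\<close>

lemma exp_const_imp_const:
  fixes h :: "'a::topological_space \<Rightarrow> complex"
  assumes "connected S" "continuous_on S h"
    and eq: "\<And>x y. x \<in> S \<Longrightarrow> y \<in> S \<Longrightarrow> exp (h x) = exp (h y)"
    and "x \<in> S" "y \<in> S"
  shows "h x = h y"
proof -
  have "h constant_on S"
  proof (rule continuous_discrete_range_constant[OF assms(1,2)])
    fix u assume u: "u \<in> S"
    have "2 * pi \<le> norm (h v - h u)" if v: "v \<in> S" "h v \<noteq> h u" for v
    proof -
      obtain n :: int where n: "h v = h u + of_int (2 * n) * pi * \<i>"
        using eq[OF v(1) u] by (auto simp: exp_eq)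
      with v have "n \<noteq> 0" by auto
      hence "1 \<le> \<bar>real_of_int n\<bar>" by linarith
      thus ?thesis by (simp add: n norm_mult)
    qed
    thus "\<exists>e>0. \<forall>v. v \<in> S \<and> h v \<noteq> h u \<longrightarrow> e \<le> norm (h v - h u)"
      by (intro exI[of _ "2 * pi"]) auto
  qed
  thus ?thesis
    using assms(4,5) by (auto simp: constant_on_def)
qed

text \<open>The quotient by the conjugate removes the modulus and keeps the argument modulo pi,
  which is exactly the information carried by a phase angle.\<close>

lemma exp_twice_Im: "exp (2 * \<i> * of_real (Im w)) = exp w / cnj (exp w)"
proof -
  have "2 * \<i> * of_real (Im w) = w - cnj w"
    by (simp add: complex_eq_iff)
  thus ?thesis
    by (simp add: exp_diff exp_cnj)
qed

lemma cnj_det: "cnj (det A) = det (\<chi> i j. cnj (A $ i $ j))"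
  by (simp add: det_def)

lemma det_nonzero_iff_ker:
  fixes A :: "'a::field^'n^'n"
  shows "det A \<noteq> 0 \<longleftrightarrow> (\<forall>v. A *v v = 0 \<longrightarrow> v = 0)"
  by (simp add: invertible_left_inverse matrix_left_invertible_ker flip: invertible_det_nz)

section \<open>Factorization of a pencil by its phase angles\<close>

text \<open>The homogeneous form of \<open>pencil_det\<close>, with \<open>(a, b)\<close> in place of \<open>(cos z, sin z)\<close>.\<close>

definition pencil :: "real^'n^'n \<Rightarrow> real^'n^'n \<Rightarrow> complex \<Rightarrow> complex \<Rightarrow> complex" where
  "pencil N M a b = det (\<chi> i j. a * of_real (N $ i $ j) - b * of_real (M $ i $ j))"

lemma pencil_det_eq: "pencil_det N M z = pencil N M (cos z) (sin z)"
  by (simp add: pencil_det_def pencil_def)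

lemma pencil_scale:
  fixes N :: "real^'n^'n"
  shows "pencil N M (k * a) (k * b) = k ^ CARD('n) * pencil N M a b"
  unfolding pencil_def
  by (subst det_scale[symmetric]) (simp add: algebra_simps)

lemma cnj_pencil: "cnj (pencil N M a b) = pencil N M (cnj a) (cnj b)"
  by (simp add: pencil_def cnj_det)

lemma continuous_on_pencil:
  fixes N M :: "'a::topological_space \<Rightarrow> real^'n^'n"
  assumes "\<And>i j. continuous_on S (\<lambda>x. N x $ i $ j)" "\<And>i j. continuous_on S (\<lambda>x. M x $ i $ j)"
    and "continuous_on S a" "continuous_on S b"
  shows "continuous_on S (\<lambda>x. pencil (N x) (M x) (a x) (b x))"
  unfolding pencil_def det_def by (auto intro!: continuous_intros assms)

text \<open>The derivative of exp (2 i z) never vanishes, so this map is a local coordinate and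
  preserves the multiplicity of roots; the zero-free factor \<open>c\<close> does not change
  it.\<close>

lemma zorder_poly_exp:
  assumes p: "p \<noteq> 0" and c: "c holomorphic_on UNIV" "\<And>z. c z \<noteq> 0"
  shows "zorder (\<lambda>z. c z * poly p (exp (2 * \<i> * z))) t = int (order (exp (2 * \<i> * t)) p)"
proof -
  let ?e = "\<lambda>z. exp (2 * \<i> * z)"
  let ?m = "order (?e t) p"
  obtain q where q: "p = [:- ?e t, 1:] ^ ?m * q" and "\<not> [:- ?e t, 1:] dvd q"
    using order_decomp[OF p] by blast
  hence q0: "poly q (?e t) \<noteq> 0"
    by (simp add: poly_eq_0_iff_dvd)
  have e: "?e holomorphic_on UNIV"
    by (intro holomorphic_intros)
  define h where "h = (\<lambda>z. if z = t then deriv ?e t else (?e z - ?e t) / (z - t))"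
  have h: "h holomorphic_on UNIV"
    unfolding h_def by (rule pole_lemma_open[OF e]) simp
  have "deriv ?e t = 2 * \<i> * ?e t"
    by (rule DERIV_imp_deriv) (auto intro!: derivative_eq_intros)
  hence h0: "h t \<noteq> 0"
    by (simp add: h_def)
  define g where "g = (\<lambda>z. c z * h z ^ ?m * poly q (?e z))"
  show ?thesis
  proof (rule zorder_eqI)
    show "g holomorphic_on UNIV"
      unfolding g_def by (intro holomorphic_intros h c)
    show "g t \<noteq> 0"
      using h0 q0 c by (simp add: g_def)
    fix w assume w: "w \<noteq> t"
    have "?e w - ?e t = h w * (w - t)"
      using w by (simp add: h_def)
    moreover have "poly p (?e w) = (?e w - ?e t) ^ ?m * poly q (?e w)"
      by (subst q) simp
    ultimately show "c w * poly p (?e w) = g w * (w - t) powi int ?m"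
      by (simp add: g_def power_mult_distrib)
  qed auto
qed

lemma exp_twice_eq_iff:
  "exp (2 * \<i> * of_real s) = exp (2 * \<i> * of_real t) \<longleftrightarrow> (\<exists>k::int. s = t + of_int k * pi)"
proof -
  have "2 * \<i> * of_real s = 2 * \<i> * of_real t + of_real (of_int (2 * k) * pi) * \<i>
      \<longleftrightarrow> s = t + of_int k * pi" for k :: int
    by (auto simp: complex_eq_iff)
  thus ?thesis
    unfolding exp_eq by metis
qed

text \<open>In the variable \<open>w = exp (2 i z)\<close> the pencil is a polynomial of degree at most \<open>n\<close>,
  so the real phase angles, being \<open>n\<close> in number, account for all of its roots.\<close>

lemma phase_angles_factor:
  fixes N M :: "real^'n^'n"
  assumes ph: "phase_angles N M \<phi>" and nz: "pencil N M 1 \<i> \<noteq> 0"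
  obtains c where "c \<noteq> 0"
    "\<And>a b. pencil N M a b = c * (\<Prod>j\<in>UNIV. a * of_real (sin (\<phi> j)) - b * of_real (cos (\<phi> j)))"
proof -
  \<comment> \<open>With (a, b) = (1 + w, i (1 - w)) the matrix a N - b M becomes (N - i M) + w (N +
    i M), linear in w. The value at w = 0 is the pencil at (1, i), nonzero by assumption.\<close>
  define p where "p = det (\<chi> i j. [:of_real (N $ i $ j) - \<i> * of_real (M $ i $ j),
                                    of_real (N $ i $ j) + \<i> * of_real (M $ i $ j):])"
  have poly_p: "poly p w = pencil N M (1 + w) (\<i> * (1 - w))" for w
    unfolding p_def pencil_def det_def
    by (simp add: poly_sum poly_prod algebra_simps)
  have p0: "p \<noteq> 0"
    using nz poly_p[of 0] by auto
  have deg: "degree p \<le> CARD('n)"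
    unfolding p_def det_def
  proof (intro degree_sum_le)
    fix s :: "'n \<Rightarrow> 'n"
    let ?A = "(\<chi> i j. [:of_real (N $ i $ j) - \<i> * of_real (M $ i $ j),
                                    of_real (N $ i $ j) + \<i> * of_real (M $ i $ j):]) :: complex poly^'n^'n"
    have "degree (of_int (sign s) * (\<Prod>i\<in>UNIV. ?A $ i $ s i))
        \<le> degree (of_int (sign s) :: complex poly) + degree (\<Prod>i\<in>UNIV. ?A $ i $ s i)"
      by (rule degree_mult_le)
    also have "degree (of_int (sign s) :: complex poly) = 0"
      by simp
    also have "degree (\<Prod>i\<in>UNIV. ?A $ i $ s i) \<le> (\<Sum>i\<in>UNIV. degree (?A $ i $ s i))"
      using degree_prod_sum_le[of UNIV "\<lambda>i. ?A $ i $ s i"] by (simp add: o_def)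
    also have "\<dots> \<le> (\<Sum>i\<in>(UNIV::'n set). 1)"
      by (intro sum_mono) simp
    finally show "degree (of_int (sign s) * (\<Prod>i\<in>UNIV. ?A $ i $ s i)) \<le> CARD('n)"
      by simp
  qed simp
  define w where "w = (\<lambda>j. exp (2 * \<i> * of_real (\<phi> j)) :: complex)"
  define k where "k = (\<lambda>z::complex. exp (- \<i> * z) / 2)"
  have pd: "pencil_det N M z = k z ^ CARD('n) * poly p (exp (2 * \<i> * z))" for z
  proof -
    have "exp (\<i> * z) * exp (- \<i> * z) = 1"
      by (simp flip: exp_add)
    hence "exp (- \<i> * z) * exp (2 * \<i> * z) = exp (\<i> * z)"
      by (simp flip: exp_add)
    hence "cos z = k z * (1 + exp (2 * \<i> * z))" "sin z = k z * (\<i> * (1 - exp (2 * \<i> * z)))"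
      by (simp_all add: k_def cos_exp_eq sin_exp_eq' ring_distribs)
    thus ?thesis
      by (simp add: pencil_det_eq poly_p pencil_scale)
  qed
  have ord: "order (w i) p = card {j. w j = w i}" for i
  proof -
    have "zorder (pencil_det N M) (of_real (\<phi> i)) = int (order (w i) p)"
      unfolding pd[abs_def] w_def
      by (rule zorder_poly_exp[OF p0]) (auto simp: k_def intro!: holomorphic_intros)
    with ph show ?thesis
      unfolding phase_angles_def w_def exp_twice_eq_iff by (metis of_nat_eq_iff)
  qed
  define R where "R = {z. poly p z = 0}"
  have R: "finite R" "range w \<subseteq> R"
  proof -
    have "poly p (w i) = 0" for i
    proof -
      have "card {j. w j = w i} \<noteq> 0" by auto
      thus ?thesis using ord[of i] by (metis order_root)
    qed
    thus "range w \<subseteq> R" by (auto simp: R_def)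
  qed (simp add: R_def poly_roots_finite p0)
  \<comment> \<open>\<open>q\<close> collects the roots \<open>w j\<close> with their full
    multiplicities in \<open>p\<close>, and \<open>r\<close> collects all other roots. Since
    \<open>q\<close> already has degree n, nothing but a constant remains for
    \<open>r\<close>.\<close>
  define q where "q = (\<Prod>j\<in>UNIV. [:- w j, 1:])"
  define r where "r = smult (lead_coeff p) (\<Prod>z\<in>R - range w. [:- z, 1:] ^ order z p)"
  have "q = (\<Prod>z\<in>range w. \<Prod>j | j \<in> UNIV \<and> w j = z. [:- w j, 1:])"
    unfolding q_def by (rule prod.image_gen) simp
  also have "\<dots> = (\<Prod>z\<in>range w. [:- z, 1:] ^ order z p)"
  proof (rule prod.cong)
    fix z assume "z \<in> range w"
    then obtain i where "z = w i" by blast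
    hence "(\<Prod>j | j \<in> UNIV \<and> w j = z. [:- w j, 1:]) = (\<Prod>j | w j = z. [:- z, 1:])"
      by (intro prod.cong) auto
    thus "(\<Prod>j | j \<in> UNIV \<and> w j = z. [:- w j, 1:]) = [:- z, 1:] ^ order z p"
      using ord[of i] \<open>z = w i\<close> by simp
  qed simp
  finally have "q * (\<Prod>z\<in>R - range w. [:- z, 1:] ^ order z p) = (\<Prod>z\<in>R. [:- z, 1:] ^ order z p)"
    using prod.subset_diff[OF R(2,1), of "\<lambda>z. [:- z, 1:] ^ order z p"] by (simp add: mult.commute)
  hence pqr: "p = q * r"
    using complex_poly_decompose[of p] by (simp add: r_def R_def)
  have "degree q = CARD('n)"
    unfolding q_def by (subst degree_prod_sum_eq) auto
  moreover have "degree p = degree q + degree r"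
    using p0 pqr by (metis degree_mult_eq mult_eq_0_iff)
  ultimately have "degree r = 0"
    using deg by simp
  then obtain r0 where r0: "r = [:r0:]"
    by (metis degree_eq_zeroE)
  have "r0 \<noteq> 0"
    using p0 pqr r0 by auto
  have pw: "poly p x = r0 * (\<Prod>j\<in>UNIV. x - w j)" for x
    by (simp add: pqr r0 q_def poly_prod)
  define P where "P = (\<lambda>a b. \<Prod>j\<in>UNIV. a * of_real (sin (\<phi> j)) - b * of_real (cos (\<phi> j)) :: complex)"
  define c where "c = r0 * (\<Prod>j\<in>UNIV. - \<i> * exp (\<i> * of_real (\<phi> j)))"
  have eq: "pencil N M a b = c * P a b" if ab: "a \<noteq> \<i> * b" for a b
  proof -
    \<comment> \<open>Solving (a, b) = l (1 + x, i (1 - x)) for \<open>l\<close> and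
      \<open>x\<close>; the excluded line a = i b corresponds to x at infinity.\<close>
    define l where "l = (a - \<i> * b) / 2"
    define x where "x = (a + \<i> * b) / (a - \<i> * b)"
    have l: "l \<noteq> 0" "a = l * (1 + x)" "b = l * (\<i> * (1 - x))"
      using ab by (simp_all add: l_def x_def field_simps)
    have "l * (x - w j) = - \<i> * exp (\<i> * of_real (\<phi> j)) * (a * of_real (sin (\<phi> j)) - b * of_real (cos (\<phi> j)))" for j
    proof -
      have e: "exp (\<i> * of_real (\<phi> j)) = of_real (cos (\<phi> j)) + \<i> * of_real (sin (\<phi> j))"
        by (simp add: exp_Euler cos_of_real sin_of_real)
      have w: "w j = (of_real (cos (\<phi> j)) + \<i> * of_real (sin (\<phi> j)))\<^sup>2"
        unfolding w_def e[symmetric] by (simp add: exp_double[symmetric] mult.assoc)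
      have u: "(of_real (cos (\<phi> j)) :: complex)\<^sup>2 + (of_real (sin (\<phi> j)))\<^sup>2 = 1"
        by (simp flip: of_real_power of_real_add)
      show ?thesis
        unfolding w e l(2,3) using u i_squared by algebra
    qed
    hence "l ^ CARD('n) * (\<Prod>j\<in>UNIV. x - w j)
         = (\<Prod>j\<in>UNIV. - \<i> * exp (\<i> * of_real (\<phi> j))) * P a b"
      unfolding P_def by (simp flip: prod.distrib prod_constant)
    moreover have "pencil N M a b = l ^ CARD('n) * poly p x"
      by (simp only: poly_p l(2,3) pencil_scale)
    ultimately show ?thesis
      by (simp add: pw c_def mult_ac)
  qed
  have "pencil N M a b = c * P a b" for a b
  proof (cases "a = \<i> * b")
    case True
    \<comment> \<open>On the excluded line the identity follows by continuity in the first
      argument.\<close>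
    have "isCont (\<lambda>x. pencil N M x b) a"
      by (rule continuous_on_interior[where S = UNIV]) (auto intro!: continuous_on_pencil continuous_intros)
    hence 1: "((\<lambda>x. pencil N M x b) \<longlongrightarrow> pencil N M a b) (at a)"
      by (simp add: isCont_def)
    have "isCont (\<lambda>x. c * P x b) a"
      unfolding P_def by (intro continuous_intros)
    hence 2: "((\<lambda>x. c * P x b) \<longlongrightarrow> c * P a b) (at a)"
      by (simp add: isCont_def)
    have "((\<lambda>x. pencil N M x b) \<longlongrightarrow> c * P a b) (at a)"
      by (rule Lim_transform_eventually[OF 2]) (auto simp: eventually_at_filter eq True)
    thus ?thesis
      using 1 tendsto_unique by (metis at_neq_bot)
  qed (rule eq)
  moreover have "c \<noteq> 0"
    using \<open>r0 \<noteq> 0\<close> by (simp add: c_def)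
  ultimately show ?thesis
    using that by (simp add: P_def)
qed

text \<open>At (1, i) the factor of \<phi> j is - i exp (i \<phi> j), and at (1, - i) it is i exp (-
  i \<phi> j), so each angle contributes - exp (2 i \<phi> j) to the quotient. The conjugate is the
  pencil at (1, - i), with the same constant \<open>c\<close>, which therefore cancels.\<close>

lemma sum_phase_angles:
  fixes N M :: "real^'n^'n"
  assumes "phase_angles N M \<phi>" "pencil N M 1 \<i> \<noteq> 0"
  shows "exp (2 * \<i> * of_real (\<Sum>j\<in>UNIV. \<phi> j))
       = (-1) ^ CARD('n) * pencil N M 1 \<i> / cnj (pencil N M 1 \<i>)"
proof -
  obtain c where c: "c \<noteq> 0" "\<And>a b. pencil N M a b
      = c * (\<Prod>j\<in>UNIV. a * of_real (sin (\<phi> j)) - b * of_real (cos (\<phi> j)))"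
    using phase_angles_factor[OF assms] by blast
  let ?e = "\<lambda>x. exp (\<i> * of_real x) :: complex"
  have e: "of_real (sin x) - \<i> * of_real (cos x) = - \<i> * ?e x"
    "of_real (sin x) + \<i> * of_real (cos x) = \<i> * ?e (- x)" for x
    by (simp_all add: complex_eq_iff Re_exp Im_exp)
  have "pencil N M 1 \<i> = c * (\<Prod>j\<in>UNIV. - \<i> * ?e (\<phi> j))"
    by (simp only: c(2) e mult_1)
  moreover have "cnj (pencil N M 1 \<i>) = c * (\<Prod>j\<in>UNIV. \<i> * ?e (- \<phi> j))"
  proof -
    have "cnj (pencil N M 1 \<i>) = pencil N M 1 (- \<i>)"
      by (simp add: cnj_pencil)
    thus ?thesis
      unfolding c(2) e(2)[symmetric] by simp
  qed
  moreover have "exp (2 * \<i> * of_real (\<Sum>j\<in>UNIV. \<phi> j)) = (\<Prod>j\<in>UNIV. ?e (\<phi> j) / ?e (- \<phi> j))"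
    by (simp add: exp_sum sum_distrib_left mult.assoc flip: exp_diff)
  moreover have "- \<i> * z = (-1) * (\<i> * z)" for z
    by simp
  ultimately show ?thesis
    using c(1) by (simp only: prod.distrib prod_dividef prod_constant) (simp add: power_mult_distrib[symmetric] mult.assoc[symmetric])
qed

section \<open>Lagrangian pairs\<close>

text \<open>The pairs (N v, M v) form an n-dimensional space that is isotropic for the symplectic
  form with weights \<open>a\<close>. For invertible M this says that N M^-1 is self-adjoint in the
  weighted inner product; the present form also covers singular M.\<close>

definition lagrangian_pair :: "real^'n^'n \<Rightarrow> real^'n^'n \<Rightarrow> bool" where
  "lagrangian_pair N M \<longleftrightarrow>
     (\<exists>a. (\<forall>k. 0 < a k) \<and>
        (\<forall>u v. (\<Sum>k\<in>UNIV. a k * (M *v u) $ k * (N *v v) $ k)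
             = (\<Sum>k\<in>UNIV. a k * (N *v u) $ k * (M *v v) $ k))) \<and>
     (\<forall>v. N *v v = 0 \<and> M *v v = 0 \<longrightarrow> v = 0)"

lemma weighted_square_sum_eq_0:
  fixes v :: "real^'n"
  assumes "\<And>k. 0 < a k" "(\<Sum>k\<in>UNIV. a k * v $ k * v $ k) = 0"
  shows "v = 0"
proof -
  have "a k * v $ k * v $ k = 0" for k
    using assms by (subst (asm) sum_nonneg_eq_0_iff) (auto simp: less_imp_le mult.assoc)
  thus ?thesis
    using assms(1) by (simp add: vec_eq_iff) (metis less_irrefl)
qed

text \<open>A self-adjoint operator has no purely imaginary nonzero eigenvalue. In terms of pairs: a
  kernel vector x + i y gives N x = - t M y and N y = t M x, and the symmetry makes the weighted
  square norms of M x and M y add up to 0.\<close>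

lemma pencil_nonzero:
  fixes N M :: "real^'n^'n" and t :: real
  assumes lag: "lagrangian_pair N M" and t: "t \<noteq> 0"
  shows "pencil N M 1 (\<i> * of_real t) \<noteq> 0"
  unfolding pencil_def det_nonzero_iff_ker
proof (intro allI impI)
  fix v :: "complex^'n"
  let ?A = "(\<chi> i j. 1 * of_real (N $ i $ j) - \<i> * of_real t * of_real (M $ i $ j)) :: complex^'n^'n"
  assume v: "?A *v v = 0"
  obtain a where a: "\<And>k. 0 < a k"
    and sym: "\<And>u v. (\<Sum>k\<in>UNIV. a k * (M *v u) $ k * (N *v v) $ k)
             = (\<Sum>k\<in>UNIV. a k * (N *v u) $ k * (M *v v) $ k)"
    and ker: "\<And>v. N *v v = 0 \<Longrightarrow> M *v v = 0 \<Longrightarrow> v = 0"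
    using lag unfolding lagrangian_pair_def by blast
  define x y where "x = (\<chi> j. Re (v $ j))" and "y = (\<chi> j. Im (v $ j))"
  have A: "(?A *v v) $ k = Complex ((N *v x) $ k + t * (M *v y) $ k) ((N *v y) $ k - t * (M *v x) $ k)" for k
    by (simp add: complex_eq_iff matrix_vector_mult_def x_def y_def sum_distrib_left
        algebra_simps flip: sum.distrib sum_subtractf)
  have "Complex ((N *v x) $ k + t * (M *v y) $ k) ((N *v y) $ k - t * (M *v x) $ k) = 0" for k
    unfolding A[symmetric] v by simp
  hence *: "(N *v x) $ k = - t * (M *v y) $ k" "(N *v y) $ k = t * (M *v x) $ k" for k
    by (simp_all add: complex_eq_iff eq_neg_iff_add_eq_0)
  define s where "s = (\<lambda>u. \<Sum>k\<in>UNIV. a k * (M *v u) $ k * (M *v u) $ k)"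
  have "(\<Sum>k\<in>UNIV. a k * (M *v x) $ k * (N *v y) $ k) = t * s x"
    "(\<Sum>k\<in>UNIV. a k * (N *v x) $ k * (M *v y) $ k) = - t * s y"
    unfolding s_def sum_distrib_left * by (intro sum.cong refl; algebra)+
  hence "t * (s x + s y) = 0"
    using sym[of x y] by (simp add: distrib_left)
  hence "s x + s y = 0"
    using t by simp
  moreover have "0 \<le> s u" for u
    unfolding s_def using a by (intro sum_nonneg) (simp add: less_imp_le mult.assoc)
  ultimately have "s x = 0" "s y = 0"
    by (simp_all add: add_nonneg_eq_0_iff)
  hence M: "M *v x = 0" "M *v y = 0"
    using weighted_square_sum_eq_0[of a] a by (simp_all add: s_def)
  hence "N *v x = 0" "N *v y = 0"
    by (simp_all add: vec_eq_iff *)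
  with M have "x = 0" "y = 0"
    using ker by blast+
  thus "v = 0"
    by (simp add: x_def y_def vec_eq_iff complex_eq_iff)
qed

lemma matrix_diff_ldistrib: "A ** (B - C) = A ** B - A ** C"
  and matrix_diff_rdistrib: "(A - B) ** C = A ** C - B ** C"
  for A B C :: "real^'n^'n"
  by (simp_all add: vec_eq_iff matrix_matrix_mult_def algebra_simps sum_subtractf)

section \<open>Splitting off the kernel of \<open>N\<close>\<close>

lemma kernel_projection:
  fixes N :: "real^'n^'n"
  obtains Q where "N ** Q = 0" "Q ** Q = Q" "\<And>v. N *v v = 0 \<Longrightarrow> Q *v v = v"
proof -
  let ?V = "{v. N *v v = 0}"
  have "subspace ?V"
    by (auto simp: subspace_def matrix_vector_right_distrib scaleR_matrix_vector_assoc[symmetric]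
        matrix_vector_mult_scaleR)
  moreover have "linear (\<lambda>v::real^'n. v)"
    by (simp add: linear_iff)
  ultimately obtain g where g: "range g \<subseteq> ?V" "linear g" "\<forall>v\<in>?V. g v = v"
    using linear_exists_left_inverse_on[of "\<lambda>v. v" ?V] by auto
  let ?Q = "matrix g"
  have Q: "?Q *v v = g v" for v
    using g(2) by (rule matrix_works[OF linear_matrix_vector_mul_eq[THEN iffD2]])
  have "N *v g v = 0" "g (g v) = g v" for v
    using g by auto
  hence "N ** ?Q = 0" "?Q ** ?Q = ?Q"
    by (simp_all add: matrix_eq Q flip: matrix_vector_mul_assoc)
  thus ?thesis
    using that g(3) by (simp add: Q)
qed

text \<open>On the kernel of \<open>N\<close>, the range of \<open>Q\<close>, the pencil acts as - b
  M. Here this - b is replaced by 1, while the complementary range of 1 - Q keeps the original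
  pencil; \<open>ker_factor\<close> holds the factor taken out.\<close>

definition deflated :: "real^'n^'n \<Rightarrow> real^'n^'n \<Rightarrow> real^'n^'n \<Rightarrow> complex \<Rightarrow> complex \<Rightarrow> complex" where
  "deflated N M Q a b = det (\<chi> i j. a * of_real (N $ i $ j)
     - b * of_real ((M ** (mat 1 - Q)) $ i $ j) + of_real ((M ** Q) $ i $ j))"

definition ker_factor :: "real^'n^'n \<Rightarrow> complex \<Rightarrow> complex" where
  "ker_factor Q b = det (\<chi> i j. of_real ((mat 1 - Q) $ i $ j) - b * of_real (Q $ i $ j))"

text \<open>Splitting off the kernel of \<open>N\<close> leaves a determinant that does not vanish at \<open>b = 0\<close>;
  the other factor depends on the kernel only.\<close>

lemma pencil_deflate:
  fixes N M Q :: "real^'n^'n"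
  assumes Q: "N ** Q = 0" "Q ** Q = Q"
  shows "pencil N M a b = deflated N M Q a b * ker_factor Q b"
proof -
  define R where "R = mat 1 - Q"
  define A :: "complex^'n^'n" where "A = (\<chi> i j. a * of_real (N $ i $ j)
     - b * of_real ((M ** R) $ i $ j) + of_real ((M ** Q) $ i $ j))"
  define B :: "complex^'n^'n" where "B = (\<chi> i j. of_real (R $ i $ j) - b * of_real (Q $ i $ j))"
  define C :: "complex^'n^'n" where "C = (\<chi> i j. a * of_real (N $ i $ j) - b * of_real (M $ i $ j))"
  have R: "N ** R = N" "R ** R = R" "R ** Q = 0" "Q ** R = 0" "M ** R + M ** Q = M"
    by (simp_all add: R_def matrix_diff_ldistrib matrix_diff_rdistrib Q)
  have expand: "(\<Sum>k\<in>UNIV. (a * n k - b * p k + q k) * (r k - b * s k))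
      = a * (\<Sum>k\<in>UNIV. n k * r k) - b * (\<Sum>k\<in>UNIV. p k * r k) + (\<Sum>k\<in>UNIV. q k * r k)
        - b * (a * (\<Sum>k\<in>UNIV. n k * s k) - b * (\<Sum>k\<in>UNIV. p k * s k) + (\<Sum>k\<in>UNIV. q k * s k))"
    for n p q r s :: "'n \<Rightarrow> complex"
    by (simp add: sum_distrib_left algebra_simps sum.distrib sum_subtractf)
  have p: "(\<Sum>k\<in>UNIV. of_real (X $ i $ k) * of_real (Y $ k $ j)) = (of_real ((X ** Y) $ i $ j) :: complex)"
    for X Y :: "real^'n^'n" and i j
    by (simp add: matrix_matrix_mult_def)
  \<comment> \<open>The complementary projections \<open>R\<close> and \<open>Q\<close> annihilate
    each other and N Q = 0, so all mixed terms of the product vanish.\<close>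
  have "(A ** B) $ i $ j = C $ i $ j" for i j
  proof -
    have "(A ** B) $ i $ j = (\<Sum>k\<in>UNIV. A $ i $ k * B $ k $ j)"
      by (simp add: matrix_matrix_mult_def)
    also have "\<dots> = a * of_real (N $ i $ j) - b * of_real ((M ** R) $ i $ j + (M ** Q) $ i $ j)"
      unfolding A_def B_def vec_lambda_beta expand p matrix_mul_assoc[symmetric] R(1-4) Q
      by (simp add: algebra_simps)
    also have "\<dots> = C $ i $ j"
      unfolding vector_add_component[symmetric] R(5) by (simp add: C_def)
    finally show ?thesis .
  qed
  hence "C = A ** B"
    by (simp add: vec_eq_iff)
  hence "det C = det A * det B"
    by (simp only: det_mul)
  thus ?thesis
    unfolding pencil_def deflated_def ker_factor_def A_def B_def C_def R_def .
qed

lemma deflated_real: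
  "deflated N M Q 1 0 = of_real (det (N + M ** Q))"
  unfolding deflated_def det_cmat[symmetric]
  by (intro arg_cong[of _ _ det]) (simp add: vec_eq_iff cmat_def)

text \<open>For t other than 0 this is a factor of a nonvanishing pencil. At t = 0 a kernel vector
  v, with u = Q v in the kernel of \<open>N\<close>, satisfies N v = - M u; the symmetry for u and v
  then gives M u = 0, so u = 0 and v = Q v = u = 0.\<close>

lemma deflated_nonzero:
  fixes N M Q :: "real^'n^'n"
  assumes lag: "lagrangian_pair N M"
    and Q: "N ** Q = 0" "Q ** Q = Q" "\<And>v. N *v v = 0 \<Longrightarrow> Q *v v = v"
  shows "deflated N M Q 1 (\<i> * of_real t) \<noteq> 0"
proof (cases "t = 0")
  case False
  thus ?thesis
    using pencil_nonzero[OF lag False] pencil_deflate[OF Q(1,2)] by auto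
next
  case True
  have "det (N + M ** Q) \<noteq> 0"
    unfolding det_nonzero_iff_ker
  proof (intro allI impI)
    fix v assume v: "(N + M ** Q) *v v = 0"
    obtain a where a: "\<And>k. 0 < a k"
      and sym: "\<And>u v. (\<Sum>k\<in>UNIV. a k * (M *v u) $ k * (N *v v) $ k)
               = (\<Sum>k\<in>UNIV. a k * (N *v u) $ k * (M *v v) $ k)"
      and ker: "\<And>v. N *v v = 0 \<Longrightarrow> M *v v = 0 \<Longrightarrow> v = 0"
      using lag unfolding lagrangian_pair_def by blast
    define u where "u = Q *v v"
    have Nu: "N *v u = 0"
      by (simp add: u_def Q matrix_vector_mul_assoc)
    have "N *v v = - (M *v u)"
      using v by (simp add: u_def matrix_vector_mult_add_rdistrib matrix_vector_mul_assoc eq_neg_iff_add_eq_0)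
    hence "(\<Sum>k\<in>UNIV. a k * (M *v u) $ k * (M *v u) $ k) = 0"
      using sym[of u v] by (simp add: Nu sum_negf)
    hence Mu: "M *v u = 0"
      by (intro weighted_square_sum_eq_0[of a]) (auto simp: a)
    hence "u = 0"
      using ker Nu by blast
    moreover have "Q *v v = v"
      using \<open>N *v v = - (M *v u)\<close> Mu by (intro Q(3)) simp
    ultimately show "v = 0"
      by (simp add: u_def)
  qed
  thus ?thesis
    by (simp add: True deflated_real)
qed

text \<open>The multiplicity of the angle 0 comes entirely from the kernel factor. The right-hand
  side does not mention \<open>M\<close>, so this multiplicity is the same for all admissible
  \<open>M\<close>.\<close>

lemma zorder_pencil_at_0:
  fixes N M Q :: "real^'n^'n"
  assumes lag: "lagrangian_pair N M"
    and Q: "N ** Q = 0" "Q ** Q = Q" "\<And>v. N *v v = 0 \<Longrightarrow> Q *v v = v"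
  shows "zorder (pencil_det N M) 0 = zorder (\<lambda>z. ker_factor Q (sin z)) 0"
proof -
  let ?f = "\<lambda>z. deflated N M Q (cos z) (sin z)" and ?g = "\<lambda>z. ker_factor Q (sin z)"
  have fg: "pencil_det N M = (\<lambda>z. ?f z * ?g z)"
    by (simp add: pencil_det_eq pencil_deflate[OF Q(1,2)] fun_eq_iff)
  have an: "?f analytic_on {0}" "?g analytic_on {0}"
    unfolding deflated_def ker_factor_def det_def by (auto intro!: analytic_intros)
  have "zorder ?f 0 = 0"
    using deflated_nonzero[OF assms, of 0] by (intro zorder_eq_0I an) simp
  \<comment> \<open>Additivity of orders requires that the product is not identically zero near 0.
    The points z = i e witness this: there (cos z, sin z) is cosh e times (1, i tanh e), where the
    Lagrangian pencil is nonzero.\<close>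
  moreover have "\<exists>\<^sub>F z in at 0. ?f z * ?g z \<noteq> 0"
    unfolding frequently_def
  proof
    assume "\<forall>\<^sub>F z in at 0. \<not> (?f z * ?g z \<noteq> 0)"
    then obtain d where d: "d > 0" "\<And>z. z \<noteq> 0 \<Longrightarrow> dist z 0 < d \<Longrightarrow> ?f z * ?g z = 0"
      by (auto simp: eventually_at)
    define e where "e = d / 2"
    have e: "0 < e" "e < d"
      using d(1) by (auto simp: e_def)
    have "cos (\<i> * of_real e) = of_real (cosh e)"
      by (simp add: cos_i_times cosh_def exp_minus scaleR_conv_of_real flip: exp_of_real)
    moreover have "sin (\<i> * of_real e) = \<i> * of_real (sinh e)"
      by (simp add: sin_i_times sinh_def exp_minus scaleR_conv_of_real flip: exp_of_real)
    moreover have "sinh e = cosh e * tanh e"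
      by (simp add: tanh_def)
    ultimately have "pencil_det N M (\<i> * of_real e)
        = of_real (cosh e) ^ CARD('n) * pencil N M 1 (\<i> * of_real (tanh e))"
      by (simp add: pencil_det_eq mult_ac flip: pencil_scale)
    moreover have "pencil N M 1 (\<i> * of_real (tanh e)) \<noteq> 0"
      by (rule pencil_nonzero[OF lag]) (use e in simp)
    ultimately have "pencil_det N M (\<i> * of_real e) \<noteq> 0"
      by simp
    moreover have "pencil_det N M (\<i> * of_real e) = 0"
      unfolding fg using e by (intro d(2)) (auto simp: norm_mult)
    ultimately show False by simp
  qed
  hence "zorder (\<lambda>z. ?f z * ?g z) 0 = zorder ?f 0 + zorder ?g 0"
    by (rule zorder_times_analytic'[OF isolated_singularity_at_analytic[OF an(1)]
        not_essential_analytic[OF an(1)] an(2)])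
  ultimately show ?thesis
    unfolding fg by linarith
qed

section \<open>Shift of the phase angles along a path\<close>

text \<open>The factor that an angle \<rho> contributes to the pencil at (1, i t). For \<rho> in [0,
  pi) and t > 0 it lies in the closed right half-plane without 0, so the principal logarithm is
  continuous there.\<close>

definition ray :: "real \<Rightarrow> real \<Rightarrow> complex" where
  "ray \<rho> t = of_real (sin \<rho>) - \<i> * of_real t * of_real (cos \<rho>)"

lemma ray_not_nonpos:
  assumes "0 \<le> \<rho>" "\<rho> < pi" "0 < t \<or> 0 < \<rho>"
  shows "ray \<rho> t \<notin> \<real>\<^sub>\<le>\<^sub>0"
proof (cases "\<rho> = 0")
  case False
  hence "0 < sin \<rho>"
    using assms by (intro sin_gt_zero) auto
  thus ?thesis
    by (simp add: ray_def complex_nonpos_Reals_iff)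
qed (use assms in \<open>simp add: ray_def complex_nonpos_Reals_iff\<close>)

lemma ray_nonzero: "0 \<le> \<rho> \<Longrightarrow> \<rho> < pi \<Longrightarrow> 0 < t \<Longrightarrow> ray \<rho> t \<noteq> 0"
  using ray_not_nonpos[of \<rho> t] by auto

lemma Im_Ln_ray_1:
  assumes "0 \<le> \<rho>" "\<rho> < pi"
  shows "Im (Ln (ray \<rho> 1)) = \<rho> - pi / 2"
proof -
  have "ray \<rho> 1 = exp (\<i> * of_real (\<rho> - pi / 2))"
    by (simp add: ray_def complex_eq_iff Re_exp Im_exp cos_diff sin_diff)
  moreover have "Ln (exp (\<i> * of_real (\<rho> - pi / 2))) = \<i> * of_real (\<rho> - pi / 2)"
    using assms by (intro Ln_exp) auto
  ultimately show ?thesis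
    by simp
qed

text \<open>As t tends to 0 the ray of a positive angle reaches the positive real axis, while that
  of the angle 0 shrinks along the negative imaginary axis. The limit thus detects the zero
  angles.\<close>

lemma Im_Ln_ray_0:
  assumes "0 \<le> \<rho>" "\<rho> < pi"
  shows "((\<lambda>t. Im (Ln (ray \<rho> t))) \<longlongrightarrow> (if \<rho> = 0 then - pi / 2 else 0)) (at_right 0)"
proof (cases "\<rho> = 0")
  case True
  have "Im (Ln (ray \<rho> t)) = - pi / 2" if "t > 0" for t
  proof -
    have "ray \<rho> t = exp (of_real (ln t) - \<i> * of_real (pi / 2))"
      using that by (simp add: ray_def True complex_eq_iff Re_exp Im_exp)
    moreover have "Ln (exp (of_real (ln t) - \<i> * of_real (pi / 2))) = of_real (ln t) - \<i> * of_real (pi / 2)"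
      using pi_gt_zero by (intro Ln_exp) (simp_all del: pi_gt_zero)
    ultimately show ?thesis
      by simp
  qed
  thus ?thesis
    using True by (intro tendsto_eventually) (auto simp: eventually_at_filter)
next
  case False
  hence "isCont (\<lambda>t. Im (Ln (ray \<rho> t))) 0"
    using ray_not_nonpos[of \<rho> 0] assms by (auto intro!: continuous_intros simp: ray_def)
  moreover have "Im (Ln (ray \<rho> 0)) = 0"
    using False assms by (simp add: ray_def Ln_of_real sin_gt_zero)
  ultimately show ?thesis
    using False by (simp add: isCont_def filterlim_at_split)
qed

lemma phase_angles_factor_ray:
  assumes "phase_angles N M \<phi>" "lagrangian_pair N M"
  obtains c where "c \<noteq> 0" "\<And>t. pencil N M 1 (\<i> * of_real t) = c * (\<Prod>j\<in>UNIV. ray (\<phi> j) t)"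
proof -
  have "pencil N M 1 \<i> \<noteq> 0"
    using pencil_nonzero[OF assms(2), of 1] by simp
  then obtain c where c: "c \<noteq> 0" "\<And>a b. pencil N M a b
      = c * (\<Prod>j\<in>UNIV. a * of_real (sin (\<phi> j)) - b * of_real (cos (\<phi> j)))"
    using phase_angles_factor[OF assms(1)] by blast
  show ?thesis
    by (rule that[OF c(1)]) (simp add: c(2) ray_def)
qed

text \<open>Along the path \<open>M\<close> the angle \<open>0\<close> keeps its multiplicity \<open>dim (ker N)\<close>, so no phase angle
  enters or leaves \<open>[0, \<pi>)\<close>.  To compare the ends, each angle \<open>\<rho>\<close> is read off as the change
  of the argument of \<open>sin \<rho> - i t cos \<rho>\<close> for \<open>t\<close> from \<open>0\<close> to \<open>1\<close>.\<close>

lemma sum_phase_angles_shift: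
  fixes N :: "real^'n^'n" and M :: "real \<Rightarrow> real^'n^'n"
  assumes M: "\<And>i j. continuous_on {0..1} (\<lambda>s. M s $ i $ j)"
    and lag: "\<And>s. s \<in> {0..1} \<Longrightarrow> lagrangian_pair N (M s)"
    and tau: "phase_angles N (M 0) \<tau>" "\<And>j. 0 \<le> \<tau> j \<and> \<tau> j < pi"
    and rho: "phase_angles N (M 1) \<rho>" "\<And>j. 0 \<le> \<rho> j \<and> \<rho> j < pi"
    and g: "continuous_on {0..1} g" "\<And>s. s \<in> {0..1} \<Longrightarrow> exp (g s) = pencil N (M s) 1 \<i>"
  shows "Im (g 1) - Im (g 0) = (\<Sum>j\<in>UNIV. \<rho> j - \<tau> j)"
proof -
  obtain Q where Q: "N ** Q = 0" "Q ** Q = Q" "\<And>v. N *v v = 0 \<Longrightarrow> Q *v v = v"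
    using kernel_projection[of N] by blast
  \<comment> \<open>The pencil vanishes at t = 0 if \<open>N\<close> is singular; the deflated
    determinant is nonzero on the whole square and so has a continuous logarithm
    \<open>G\<close>.\<close>
  define F where "F = (\<lambda>(s, t). deflated N (M s) Q 1 (\<i> * of_real t))"
  let ?I = "{0..1::real}" and ?S = "{0..1::real} \<times> {0..1::real}"
  have M': "continuous_on ?S (\<lambda>p. M (fst p) $ i $ j)" for i j
    by (rule continuous_on_compose2[OF M[of i j]]) (auto intro!: continuous_intros)
  have "continuous_on ?S F"
    unfolding F_def deflated_def det_def matrix_matrix_mult_def case_prod_unfold
    by (auto intro!: continuous_intros M')
  moreover have "F p \<noteq> 0" if "p \<in> ?S" for p
    using that deflated_nonzero[OF lag Q] by (auto simp: F_def)
  moreover have "contractible ?S"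
    by (intro convex_imp_contractible convex_Times) auto
  ultimately obtain G where G: "continuous_on ?S G" "\<And>p. p \<in> ?S \<Longrightarrow> F p = exp (G p)"
    using continuous_logarithm_on_contractible[of ?S F] by blast
  have Gs: "continuous_on ?I (\<lambda>s. G (s, t))" if "t \<in> ?I" for t
    by (rule continuous_on_compose2[OF G(1)]) (use that in \<open>auto intro!: continuous_intros\<close>)
  have Gt: "continuous_on ?I (\<lambda>t. G (s, t))" if "s \<in> ?I" for s
    by (rule continuous_on_compose2[OF G(1)]) (use that in \<open>auto intro!: continuous_intros\<close>)
  have pen: "pencil N (M s) 1 (\<i> * of_real t) = F (s, t) * ker_factor Q (\<i> * of_real t)" for s t
    by (simp add: F_def pencil_deflate[OF Q(1,2)])
  have ker: "ker_factor Q (\<i> * of_real t) \<noteq> 0" if "t \<noteq> 0" for t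
    using pencil_nonzero[OF lag[of 0] that] pen[of 0 t] by auto

  \<comment> \<open>On the side t = 0 the determinant is real and nonzero, so its argument cannot
    move.\<close>
  have G0: "Im (G (1, 0)) = Im (G (0, 0))"
  proof -
    have "2 * \<i> * of_real (Im (G (1, 0))) = 2 * \<i> * of_real (Im (G (0, 0)))"
    proof (rule exp_const_imp_const[of ?I "\<lambda>s. 2 * \<i> * of_real (Im (G (s, 0)))"])
      have "exp (2 * \<i> * of_real (Im (G (s, 0)))) = 1" if "s \<in> ?I" for s
      proof -
        have "exp (G (s, 0)) = of_real (det (N + M s ** Q))"
          using G(2)[of "(s, 0)"] that by (simp add: F_def deflated_real)
        moreover from this have "det (N + M s ** Q) \<noteq> 0"
          by (metis exp_not_eq_zero of_real_0)
        ultimately show ?thesis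
          unfolding exp_twice_Im by simp
      qed
      thus "exp (2 * \<i> * of_real (Im (G (s, 0)))) = exp (2 * \<i> * of_real (Im (G (s', 0))))"
        if "s \<in> ?I" "s' \<in> ?I" for s s'
        using that by simp
    qed (auto intro!: continuous_intros Gs)
    thus ?thesis by simp
  qed
  \<comment> \<open>On the side t = 1, \<open>g\<close> and \<open>G\<close> differ by a logarithm
    of the kernel factor, which does not depend on s.\<close>
  have G1: "g 1 - G (1, 1) = g 0 - G (0, 1)"
  proof (rule exp_const_imp_const[of ?I "\<lambda>s. g s - G (s, 1)"])
    have "exp (g s - G (s, 1)) = ker_factor Q \<i>" if "s \<in> ?I" for s
      using g(2)[OF that] G(2)[of "(s, 1)"] pen[of s 1] that by (simp add: exp_diff)
    thus "exp (g s - G (s, 1)) = exp (g s' - G (s', 1))" if "s \<in> ?I" "s' \<in> ?I" for s s'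
      using that by simp
  qed (auto intro!: continuous_intros Gs g)

  obtain c1 where c1: "c1 \<noteq> 0" "\<And>t. pencil N (M 1) 1 (\<i> * of_real t) = c1 * (\<Prod>j\<in>UNIV. ray (\<rho> j) t)"
    using phase_angles_factor_ray[OF rho(1) lag[of 1]] by auto
  obtain c0 where c0: "c0 \<noteq> 0" "\<And>t. pencil N (M 0) 1 (\<i> * of_real t) = c0 * (\<Prod>j\<in>UNIV. ray (\<tau> j) t)"
    using phase_angles_factor_ray[OF tau(1) lag[of 0]] by auto
  define L where "L = (\<lambda>\<phi> t. \<Sum>j\<in>(UNIV::'n set). Ln (ray (\<phi> j) t))"
  \<comment> \<open>On the sides s = 0 and s = 1 the kernel factors agree and cancel, so exp (b t)
    is the constant c1 / c0. The limit t to 0 then determines Im b, and t = 1 brings in the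
    angles.\<close>
  define b where "b = (\<lambda>t. (G (1, t) - G (0, t)) - (L \<rho> t - L \<tau> t))"
  have expL: "exp (L \<phi> t) = (\<Prod>j\<in>UNIV. ray (\<phi> j) t)"
    if "t > 0" "\<And>j. 0 \<le> \<phi> j \<and> \<phi> j < pi" for \<phi> t
    unfolding L_def by (subst exp_sum) (use that ray_nonzero in \<open>auto intro!: prod.cong\<close>)
  have contL: "continuous_on {0<..1} (L \<phi>)" if "\<And>j. 0 \<le> \<phi> j \<and> \<phi> j < pi" for \<phi>
    unfolding L_def
    by (intro continuous_on_sum continuous_on_Ln)
       (use ray_not_nonpos that in \<open>auto simp: ray_def intro!: continuous_intros\<close>)
  have b_const: "b t = b 1" if t: "t \<in> {0<..1}" for t
  proof (rule exp_const_imp_const[of "{0<..1}" b])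
    show "continuous_on {0<..1} b"
      unfolding b_def
      by (intro continuous_intros contL rho tau; rule continuous_on_subset[OF Gt]) auto
    have "exp (b t) = c1 / c0" if t: "t \<in> {0<..1}" for t
    proof -
      have "exp (G (1, t)) * ker_factor Q (\<i> * of_real t) = c1 * exp (L \<rho> t)"
        "exp (G (0, t)) * ker_factor Q (\<i> * of_real t) = c0 * exp (L \<tau> t)"
        using t pen[of 1 t] pen[of 0 t] G(2)[of "(1, t)"] G(2)[of "(0, t)"]
        by (simp_all add: c1 c0 expL rho tau)
      hence "exp (G (1, t)) = c1 * exp (L \<rho> t) / ker_factor Q (\<i> * of_real t)"
        "exp (G (0, t)) = c0 * exp (L \<tau> t) / ker_factor Q (\<i> * of_real t)"
        using ker[of t] t by (simp_all add: eq_divide_eq)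
      thus ?thesis
        using ker[of t] t c0(1) by (simp add: b_def exp_diff)
    qed
    thus "exp (b t) = exp (b t')" if "t \<in> {0<..1}" "t' \<in> {0<..1}" for t t'
      using that by simp
  qed (use t in \<open>auto\<close>)

  define m where "m = (\<lambda>\<phi>. card {j::'n. \<phi> j = (0::real)})"
  have limL: "((\<lambda>t. Im (L \<phi> t)) \<longlongrightarrow> real (m \<phi>) * (- pi / 2)) (at_right 0)"
    if "\<And>j. 0 \<le> \<phi> j \<and> \<phi> j < pi" for \<phi>
  proof -
    have "((\<lambda>t. \<Sum>j\<in>UNIV. Im (Ln (ray (\<phi> j) t))) \<longlongrightarrow>
        (\<Sum>j\<in>UNIV. if \<phi> j = 0 then - pi / 2 else 0)) (at_right 0)"
      by (intro tendsto_sum Im_Ln_ray_0) (use that in auto)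
    thus ?thesis
      by (simp add: L_def m_def sum.If_cases)
  qed
  have m: "int (m \<phi>) = zorder (\<lambda>z. ker_factor Q (sin z)) 0"
    if "phase_angles N (M s) \<phi>" "s \<in> ?I" and r: "\<And>j. 0 \<le> \<phi> j \<and> \<phi> j < pi" for \<phi> s
  proof -
    have "(\<exists>k::int. \<phi> j = 0 + of_int k * pi) \<longleftrightarrow> \<phi> j = 0" for j
    proof
      assume "\<exists>k::int. \<phi> j = 0 + of_int k * pi"
      then obtain k :: int where k: "\<phi> j = of_int k * pi" by auto
      with r[of j] have "0 \<le> of_int k * pi" "of_int k * pi < 1 * pi" by simp_all
      hence "0 \<le> real_of_int k" "real_of_int k < 1"
        using pi_gt_zero by (auto simp: zero_le_mult_iff mult_less_cancel_right simp del: pi_gt_zero)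
      hence "k = 0" by linarith
      thus "\<phi> j = 0" by (simp add: k)
    next
      assume "\<phi> j = 0"
      thus "\<exists>k::int. \<phi> j = 0 + of_int k * pi"
        by (intro exI[of _ 0]) simp
    qed
    hence "int (m \<phi>) = zorder (pencil_det N (M s)) (of_real 0)"
      using that(1)[unfolded phase_angles_def, THEN spec, of 0] by (simp only: m_def)
    thus ?thesis
      using zorder_pencil_at_0[OF lag[OF that(2)] Q] by simp
  qed
  \<comment> \<open>Equally many angles are 0 at both ends, so the contributions - pi / 2 cancel in
    the limit t to 0.\<close>
  have m_eq: "m \<rho> = m \<tau>"
    using m[OF rho(1)] m[OF tau(1)] rho(2) tau(2) by simp

  have Glim: "((\<lambda>t. Im (G (s, t))) \<longlongrightarrow> Im (G (s, 0))) (at_right 0)" if "s \<in> ?I" for s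
  proof -
    have "((\<lambda>t. G (s, t)) \<longlongrightarrow> G (s, 0)) (at 0 within {0..1})"
      using Gt[OF that] by (simp add: continuous_on_def)
    thus ?thesis
      by (intro tendsto_Im) (simp add: at_within_Icc_at_right)
  qed
  have "((\<lambda>t. Im (b t)) \<longlongrightarrow> (Im (G (1, 0)) - Im (G (0, 0)))
      - (real (m \<rho>) * (- pi / 2) - real (m \<tau>) * (- pi / 2))) (at_right 0)"
    unfolding b_def minus_complex.sel by (intro tendsto_diff Glim limL rho tau) auto
  moreover have "((\<lambda>t. Im (b t)) \<longlongrightarrow> Im (b 1)) (at_right 0)"
  proof (rule tendsto_eventually)
    have "\<forall>\<^sub>F t in at_right 0. t \<in> {0<..<1::real}"
      by (rule eventually_at_right_real) simp
    thus "\<forall>\<^sub>F t in at_right 0. Im (b t) = Im (b 1)"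
      by eventually_elim (rule arg_cong[where f = Im], rule b_const, simp)
  qed
  ultimately have "Im (G (1, 0)) - Im (G (0, 0))
      - (real (m \<rho>) * (- pi / 2) - real (m \<tau>) * (- pi / 2)) = Im (b 1)"
    by (rule tendsto_unique[OF trivial_limit_at_right_real])
  hence "Im (b 1) = 0"
    by (simp add: G0 m_eq)
  hence "Im (G (1, 1)) - Im (G (0, 1)) = (\<Sum>j\<in>UNIV. \<rho> j - pi / 2) - (\<Sum>j\<in>UNIV. \<tau> j - pi / 2)"
    using rho(2) tau(2) by (simp add: b_def L_def Im_Ln_ray_1)
  also have "\<dots> = (\<Sum>j\<in>UNIV. \<rho> j - \<tau> j)"
    by (simp add: sum_subtractf)
  finally show ?thesis
    using arg_cong[OF G1, of Im] by simp
qed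

section \<open>The scalar solutions and their Pruefer angles\<close>

text \<open>\<open>sol_cos\<close> and \<open>sol_sin\<close> are the solutions of y'' + d y = 0
  with initial data (y, y') = (1, 0) and (0, 1).\<close>

definition sol_cos :: "real \<Rightarrow> real \<Rightarrow> real" where
  "sol_cos d \<delta> = xi_fun (- d * \<delta>\<^sup>2)"

definition sol_sin :: "real \<Rightarrow> real \<Rightarrow> real" where
  "sol_sin d \<delta> = \<delta> * eta0_fun (- d * \<delta>\<^sup>2)"

lemma sol_trig:
  assumes "0 < w"
  shows "sol_cos (w\<^sup>2) = (\<lambda>\<delta>. cos (w * \<delta>))" "sol_sin (w\<^sup>2) = (\<lambda>\<delta>. sin (w * \<delta>) / w)"
proof -
  have sq: "sqrt (w\<^sup>2 * \<delta>\<^sup>2) = w * \<bar>\<delta>\<bar>" for \<delta>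
    using assms by (simp add: real_sqrt_mult)
  have "\<not> w\<^sup>2 * \<delta>\<^sup>2 < 0" "0 < w\<^sup>2 * \<delta>\<^sup>2 \<longleftrightarrow> \<delta> \<noteq> 0" for \<delta>
    using assms by (simp_all add: not_less zero_less_mult_iff)
  thus "sol_cos (w\<^sup>2) = (\<lambda>\<delta>. cos (w * \<delta>))" "sol_sin (w\<^sup>2) = (\<lambda>\<delta>. sin (w * \<delta>) / w)"
    using assms by (auto simp: fun_eq_iff sol_cos_def sol_sin_def xi_fun_def eta0_fun_def sq abs_if)
qed

lemma sol_free: "sol_cos 0 = (\<lambda>\<delta>. 1)" "sol_sin 0 = (\<lambda>\<delta>. \<delta>)"
  by (auto simp: fun_eq_iff sol_cos_def sol_sin_def xi_fun_def eta0_fun_def)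

lemma sol_hyperbolic:
  assumes "0 < w"
  shows "sol_cos (- w\<^sup>2) = (\<lambda>\<delta>. cosh (w * \<delta>))" "sol_sin (- w\<^sup>2) = (\<lambda>\<delta>. sinh (w * \<delta>) / w)"
proof -
  have sq: "sqrt (w\<^sup>2 * \<delta>\<^sup>2) = w * \<bar>\<delta>\<bar>" for \<delta>
    using assms by (simp add: real_sqrt_mult)
  have "\<not> w\<^sup>2 * \<delta>\<^sup>2 < 0" for \<delta>
    by (simp add: not_less)
  moreover have "w\<^sup>2 * \<delta>\<^sup>2 \<le> 0 \<longleftrightarrow> \<delta> = 0" for \<delta>
    using assms by (simp add: mult_le_0_iff)
  ultimately show "sol_cos (- w\<^sup>2) = (\<lambda>\<delta>. cosh (w * \<delta>))" "sol_sin (- w\<^sup>2) = (\<lambda>\<delta>. sinh (w * \<delta>) / w)"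
    using assms by (auto simp: fun_eq_iff sol_cos_def sol_sin_def xi_fun_def eta0_fun_def sq abs_if)
qed

lemma sol_cases:
  fixes d :: real
  obtains w where "0 < w" "d = w\<^sup>2" | "d = 0" | w where "0 < w" "d = - w\<^sup>2"
proof (cases d "0 :: real" rule: linorder_cases)
  case less
  thus ?thesis
    using that(3)[of "sqrt (- d)"] by simp
next
  case greater
  thus ?thesis
    using that(1)[of "sqrt d"] by simp
qed (use that(2) in auto)

lemma sol_sin_deriv: "(sol_sin d has_real_derivative sol_cos d \<delta>) (at \<delta>)"
  by (cases d rule: sol_cases)
     (auto simp: sol_trig sol_free sol_hyperbolic intro!: derivative_eq_intros)

lemma sol_cos_deriv: "(sol_cos d has_real_derivative - d * sol_sin d \<delta>) (at \<delta>)"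
proof (cases d rule: sol_cases)
  case (1 w)
  show ?thesis
    unfolding 1(2) sol_trig[OF 1(1)]
    by (rule derivative_eq_intros refl)+ (use 1(1) in \<open>simp add: power2_eq_square\<close>)
next
  case 2
  show ?thesis
    unfolding 2 sol_free by simp
next
  case (3 w)
  show ?thesis
    unfolding 3(2) sol_hyperbolic[OF 3(1)]
    by (rule derivative_eq_intros refl)+ (use 3(1) in \<open>simp add: power2_eq_square\<close>)
qed

text \<open>The conserved energy of the sine-like solution, whose derivative is
  \<open>sol_cos\<close>.\<close>

lemma sol_energy: "(sol_cos d \<delta>)\<^sup>2 + d * (sol_sin d \<delta>)\<^sup>2 = 1"
  by (cases d rule: sol_cases)
     (simp_all add: sol_trig sol_free sol_hyperbolic power_divide cosh_square_eq)

lemma sol_at_0 [simp]: "sol_cos d 0 = 1" "sol_sin d 0 = 0"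
  by (simp_all add: sol_cos_def sol_sin_def xi_fun_def)

lemma sol_norm_pos: "0 < (sol_cos d \<delta>)\<^sup>2 + (sol_sin d \<delta>)\<^sup>2"
proof (rule ccontr)
  assume "\<not> 0 < (sol_cos d \<delta>)\<^sup>2 + (sol_sin d \<delta>)\<^sup>2"
  hence "sol_cos d \<delta> = 0 \<and> sol_sin d \<delta> = 0"
    by (metis not_sum_power2_lt_zero linorder_neqE_linordered_idom sum_power2_eq_zero_iff)
  thus False
    using sol_energy[of d \<delta>] by simp
qed

lemma continuous_on_sol [continuous_intros]:
  assumes "continuous_on S f"
  shows "continuous_on S (\<lambda>x. sol_cos d (f x))" "continuous_on S (\<lambda>x. sol_sin d (f x))"
proof -
  have "continuous_on UNIV (sol_cos d)" "continuous_on UNIV (sol_sin d)"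
    using sol_cos_deriv sol_sin_deriv
    by (auto intro!: continuous_at_imp_continuous_on DERIV_isCont)
  thus "continuous_on S (\<lambda>x. sol_cos d (f x))" "continuous_on S (\<lambda>x. sol_sin d (f x))"
    using assms by (auto intro: continuous_on_compose2)
qed

text \<open>The defect \<open>u\<close> of the claimed identity solves the linear equation u' = k u
  with u a = 0, so the integrating factor exp (- K) forces it to vanish.\<close>

lemma pruefer_angle:
  fixes \<theta> :: "real \<Rightarrow> real"
  assumes init: "\<theta> a = 0"
    and ode: "\<And>y. y \<in> closed_segment a b \<Longrightarrow>
      (\<theta> has_real_derivative (cos (\<theta> y))\<^sup>2 + d * (sin (\<theta> y))\<^sup>2) (at y within closed_segment a b)"
    and y: "y \<in> closed_segment a b"
  shows "sin (\<theta> y) * sol_cos d (y - a) = cos (\<theta> y) * sol_sin d (y - a)"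
proof -
  let ?S = "closed_segment a b"
  define u where "u = (\<lambda>y. sin (\<theta> y) * sol_cos d (y - a) - cos (\<theta> y) * sol_sin d (y - a))"
  define k where "k = (\<lambda>y. (d - 1) * sin (\<theta> y) * cos (\<theta> y))"
  have "continuous_on ?S \<theta>"
    using ode by (rule DERIV_continuous_on)
  hence "continuous_on ?S k"
    unfolding k_def by (intro continuous_intros)
  then obtain K where K: "\<And>y. y \<in> ?S \<Longrightarrow> (K has_real_derivative k y) (at y within ?S)"
    using antiderivative_continuous[of "min a b" "max a b" k]
    unfolding closed_segment_eq_real_ivl has_real_derivative_iff_has_vector_derivative
    by (auto split: if_splits simp: min_def max_def)
  have u: "(u has_real_derivative k y * u y) (at y within ?S)" if "y \<in> ?S" for y
  proof -
    have shift: "((\<lambda>y. y - a) has_real_derivative 1) (at y within ?S)"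
      by (auto intro!: derivative_eq_intros)
    have s: "((\<lambda>y. sol_sin d (y - a)) has_real_derivative sol_cos d (y - a)) (at y within ?S)"
      "((\<lambda>y. sol_cos d (y - a)) has_real_derivative - d * sol_sin d (y - a)) (at y within ?S)"
      using DERIV_chain2[OF sol_sin_deriv shift] DERIV_chain2[OF sol_cos_deriv shift] by simp_all
    let ?t = "(cos (\<theta> y))\<^sup>2 + d * (sin (\<theta> y))\<^sup>2"
    have "(u has_real_derivative
        (cos (\<theta> y) * ?t) * sol_cos d (y - a) + (- d * sol_sin d (y - a)) * sin (\<theta> y)
        - ((- sin (\<theta> y) * ?t) * sol_sin d (y - a) + sol_cos d (y - a) * cos (\<theta> y))) (at y within ?S)"
      unfolding u_def by (auto intro!: derivative_eq_intros ode[OF that] s)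
    also have "(cos (\<theta> y) * ?t) * sol_cos d (y - a) + (- d * sol_sin d (y - a)) * sin (\<theta> y)
        - ((- sin (\<theta> y) * ?t) * sol_sin d (y - a) + sol_cos d (y - a) * cos (\<theta> y)) = k y * u y"
      unfolding u_def k_def using sin_cos_squared_add[of "\<theta> y"] by algebra
    finally show ?thesis .
  qed
  have "((\<lambda>y. u y * exp (- K y)) has_real_derivative 0) (at y within ?S)" if "y \<in> ?S" for y
    by (rule derivative_eq_intros u[OF that] K[OF that] refl)+ (simp add: algebra_simps)
  then obtain C where C: "\<And>y. y \<in> ?S \<Longrightarrow> u y * exp (- K y) = C"
    using has_field_derivative_zero_constant[of ?S "\<lambda>y. u y * exp (- K y)"] by auto
  have "u a = 0"
    by (simp add: u_def init)
  hence "C = 0"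
    using C[of a] by simp
  hence "u y = 0"
    using C[OF y] by simp
  thus ?thesis
    by (simp add: u_def)
qed

text \<open>The vector (c, s) is a nonzero real multiple of (cos t, sin t); the multiple, whatever
  its sign, cancels in the quotient.\<close>

lemma exp_twice_angle:
  fixes t c s :: real
  assumes eq: "sin t * c = cos t * s" and pos: "0 < c\<^sup>2 + s\<^sup>2"
  shows "exp (2 * \<i> * of_real t) = (of_real c + \<i> * of_real s) / (of_real c - \<i> * of_real s)"
proof -
  let ?e = "exp (\<i> * of_real t) :: complex"
  have "?e * (of_real c - \<i> * of_real s) = cnj ?e * (of_real c + \<i> * of_real s)"
    using eq by (simp add: complex_eq_iff Re_exp Im_exp algebra_simps)
  hence "?e * (?e * (of_real c - \<i> * of_real s)) = ?e * (cnj ?e * (of_real c + \<i> * of_real s))"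
    by (rule arg_cong)
  moreover have "?e * cnj ?e = 1"
    by (simp add: exp_cnj flip: exp_add)
  moreover have "exp (2 * \<i> * of_real t) = ?e * ?e"
    by (simp add: mult.assoc flip: exp_double power2_eq_square)
  ultimately have "exp (2 * \<i> * of_real t) * (of_real c - \<i> * of_real s) = of_real c + \<i> * of_real s"
    by (metis mult.assoc mult_1)
  moreover have "of_real c - \<i> * of_real s \<noteq> (0::complex)"
    using pos by (auto simp: complex_eq_iff)
  ultimately show ?thesis
    by (simp only: eq_divide_eq if_False) simp
qed

section \<open>The propagation matrices\<close>

text \<open>The common shape of \<open>Psi_num\<close>, \<open>Omega_den\<close>,
  \<open>Psi_den\<close> (for diagonal V) and of all matrices interpolating between the two
  denominators.\<close>

definition diag_affine :: "('n \<Rightarrow> real) \<Rightarrow> ('n \<Rightarrow> real) \<Rightarrow> real^'n^'n \<Rightarrow> real^'n^'n" where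
  "diag_affine a b P = (\<chi> i j. (if i = j then a i else 0) + b i * P $ i $ j)"

lemma diag_affine_mult_vec: "(diag_affine a b P *v v) $ k = a k * v $ k + b k * (P *v v) $ k"
proof -
  have "(diag_affine a b P *v v) $ k
      = (\<Sum>j\<in>UNIV. (if k = j then a k * v $ j else 0) + b k * (P $ k $ j * v $ j))"
    by (simp add: diag_affine_def matrix_vector_mult_def distrib_right mult.assoc
        if_distrib[of "\<lambda>x. x * _"] cong: if_cong)
  thus ?thesis
    by (simp add: sum.distrib matrix_vector_mult_def sum_distrib_left)
qed

lemma continuous_on_diag_affine:
  fixes a b :: "'a::topological_space \<Rightarrow> 'n::finite \<Rightarrow> real"
  assumes "\<And>k. continuous_on S (\<lambda>x. a x k)" "\<And>k. continuous_on S (\<lambda>x. b x k)"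
  shows "continuous_on S (\<lambda>x. diag_affine (a x) (b x) P $ i $ j)"
  by (cases "i = j") (auto simp: diag_affine_def intro!: continuous_intros assms)

lemma diag_mat_mult: "(diag_mat f ** P) $ i $ j = f i * P $ i $ j"
  by (simp add: diag_mat_def matrix_matrix_mult_def if_distrib if_distribR cong: if_cong)

text \<open>In row k, N v and M v are combinations of v and P v whose 2 x 2 coefficient matrix has
  determinant - (c^2 + e s^2). Weighting by the reciprocal of c^2 + e s^2 reduces the form to that
  of the pair (P, 1), where it vanishes because P is symmetric.\<close>

lemma lagrangian_diag_affine:
  assumes sym: "transpose P = P" and pos: "\<And>k. 0 < (c k)\<^sup>2 + e k * (s k)\<^sup>2"
  shows "lagrangian_pair (diag_affine s c P) (diag_affine c (\<lambda>k. - e k * s k) P)"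
  unfolding lagrangian_pair_def
proof (intro conjI exI[of _ "\<lambda>k. 1 / ((c k)\<^sup>2 + e k * (s k)\<^sup>2)"] allI impI)
  let ?N = "diag_affine s c P" and ?M = "diag_affine c (\<lambda>k. - e k * s k) P"
  let ?a = "\<lambda>k. 1 / ((c k)\<^sup>2 + e k * (s k)\<^sup>2)"
  show "0 < ?a k" for k
    using pos by simp
  show "v = 0" if "?N *v v = 0 \<and> ?M *v v = 0" for v
  proof -
    have "((c k)\<^sup>2 + e k * (s k)\<^sup>2) * v $ k = e k * s k * (?N *v v) $ k + c k * (?M *v v) $ k" for k
      by (simp add: diag_affine_mult_vec algebra_simps power2_eq_square)
    hence "((c k)\<^sup>2 + e k * (s k)\<^sup>2) * v $ k = 0" for k
      using that by simp
    thus ?thesis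
      using pos by (simp add: vec_eq_iff) (metis less_irrefl)
  qed
  fix u v
  have "?a k * (?M *v u) $ k * (?N *v v) $ k - ?a k * (?N *v u) $ k * (?M *v v) $ k
      = u $ k * (P *v v) $ k - (P *v u) $ k * v $ k" for k
  proof -
    have "(?M *v u) $ k * (?N *v v) $ k - (?N *v u) $ k * (?M *v v) $ k
        = ((c k)\<^sup>2 + e k * (s k)\<^sup>2) * (u $ k * (P *v v) $ k - (P *v u) $ k * v $ k)"
      by (simp add: diag_affine_mult_vec algebra_simps power2_eq_square)
    moreover have "?a k * x * y - ?a k * x' * y' = (x * y - x' * y') / ((c k)\<^sup>2 + e k * (s k)\<^sup>2)"
      for x y x' y'
      by (simp add: diff_divide_distrib)
    ultimately show ?thesis
      using pos[of k] by simp
  qed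
  hence "(\<Sum>k\<in>UNIV. ?a k * (?M *v u) $ k * (?N *v v) $ k) - (\<Sum>k\<in>UNIV. ?a k * (?N *v u) $ k * (?M *v v) $ k)
      = u \<bullet> (P *v v) - (P *v u) \<bullet> v"
    by (simp add: inner_vec_def flip: sum_subtractf)
  also have "\<dots> = 0"
    using dot_lmul_matrix[of u P v] transpose_matrix_vector[of P u] by (simp add: sym)
  finally show "(\<Sum>k\<in>UNIV. ?a k * (?M *v u) $ k * (?N *v v) $ k) = (\<Sum>k\<in>UNIV. ?a k * (?N *v u) $ k * (?M *v v) $ k)"
    by simp
qed

text \<open>Row by row, (s + c P) - i (c - s P) = (c + i s) (P - i). The factors c + i s have the
  Pruefer angles as arguments modulo pi.\<close>

lemma pencil_rotation:
  fixes P :: "real^'n^'n"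
  shows "pencil (diag_affine s c P) (diag_affine c (\<lambda>k. - s k) P) 1 \<i>
       = (\<Prod>k\<in>UNIV. of_real (c k) + \<i> * of_real (s k)) * pencil P (mat 1) 1 \<i>"
proof -
  define D :: "complex^'n^'n" where "D = (\<chi> i j. if i = j then of_real (c i) + \<i> * of_real (s i) else 0)"
  define A :: "complex^'n^'n" where "A = (\<chi> i j. 1 * of_real (P $ i $ j) - \<i> * of_real (mat 1 $ i $ j))"
  have DA: "(D ** A) $ i $ j = (of_real (c i) + \<i> * of_real (s i)) * A $ i $ j" for i j
    by (simp add: D_def matrix_matrix_mult_def if_distrib if_distribR cong: if_cong)
  have "1 * of_real (diag_affine s c P $ i $ j)
      - \<i> * of_real (diag_affine c (\<lambda>k. - s k) P $ i $ j)
      = (of_real (c i) + \<i> * of_real (s i)) * A $ i $ j" for i j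
    by (simp add: A_def diag_affine_def mat_def algebra_simps)
  hence "(\<chi> i j. 1 * of_real (diag_affine s c P $ i $ j)
      - \<i> * of_real (diag_affine c (\<lambda>k. - s k) P $ i $ j)) = D ** A"
    by (simp only: vec_eq_iff DA vec_lambda_beta) simp
  hence "pencil (diag_affine s c P) (diag_affine c (\<lambda>k. - s k) P) 1 \<i> = det D * det A"
    unfolding pencil_def by (simp only: det_mul)
  moreover have "det D = (\<Prod>k\<in>UNIV. of_real (c k) + \<i> * of_real (s k))"
    by (subst det_diagonal) (simp_all add: D_def)
  ultimately show ?thesis
    by (simp add: pencil_def A_def)
qed

lemma diag_mat_nth: "diag_mat f $ i $ j = (if i = j then f i else 0)"
  by (simp add: diag_mat_def)

lemma scaleR_diag_mat: "r *\<^sub>R diag_mat f = diag_mat (\<lambda>k. r * f k)"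
  by (simp add: vec_eq_iff diag_mat_nth)

lemma xi_mat_eq: "xi_mat V E \<delta> = diag_mat (\<lambda>k. sol_cos (E - V $ k $ k) \<delta>)"
  and scaleR_eta0_mat: "\<delta> *\<^sub>R eta0_mat V E \<delta> = diag_mat (\<lambda>k. sol_sin (E - V $ k $ k) \<delta>)"
proof -
  have "Z_diag V E \<delta> k = - (E - V $ k $ k) * \<delta>\<^sup>2" for k
    by (simp add: Z_diag_def mat_def algebra_simps)
  thus "xi_mat V E \<delta> = diag_mat (\<lambda>k. sol_cos (E - V $ k $ k) \<delta>)"
    "\<delta> *\<^sub>R eta0_mat V E \<delta> = diag_mat (\<lambda>k. sol_sin (E - V $ k $ k) \<delta>)"
    by (simp_all add: xi_mat_def eta0_mat_def scaleR_diag_mat sol_cos_def sol_sin_def)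
qed

lemma Psi_num_eq:
  "Psi_num V E P \<delta> = diag_affine (\<lambda>k. sol_sin (E - V $ k $ k) \<delta>) (\<lambda>k. sol_cos (E - V $ k $ k) \<delta>) P"
  unfolding Psi_num_def xi_mat_eq scaleR_eta0_mat
  by (simp add: vec_eq_iff diag_mat_mult diag_affine_def diag_mat_nth)

lemma Omega_den_eq:
  "Omega_den V E P \<delta> = diag_affine (\<lambda>k. sol_cos (E - V $ k $ k) \<delta>) (\<lambda>k. - sol_sin (E - V $ k $ k) \<delta>) P"
  unfolding Omega_den_def xi_mat_eq scaleR_eta0_mat
  by (simp add: vec_eq_iff diag_mat_mult diag_affine_def diag_mat_nth)

lemma Psi_den_eq:
  assumes "\<And>j k. j \<noteq> k \<Longrightarrow> V $ j $ k = 0"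
  shows "Psi_den V E P \<delta> = diag_affine (\<lambda>k. sol_cos (E - V $ k $ k) \<delta>)
           (\<lambda>k. - (E - V $ k $ k) * sol_sin (E - V $ k $ k) \<delta>) P"
proof -
  have "V - E *\<^sub>R mat 1 = diag_mat (\<lambda>k. - (E - V $ k $ k))"
    using assms by (auto simp: vec_eq_iff diag_mat_nth mat_def)
  hence eq: "(\<delta> *\<^sub>R (V - E *\<^sub>R mat 1)) ** eta0_mat V E \<delta>
      = diag_mat (\<lambda>k. - (E - V $ k $ k)) ** (\<delta> *\<^sub>R eta0_mat V E \<delta>)"
    by (simp only: eta0_mat_def scaleR_diag_mat)
       (simp add: vec_eq_iff diag_mat_mult diag_mat_nth)
  show ?thesis
    unfolding Psi_den_def xi_mat_eq eq scaleR_eta0_mat matrix_mul_assoc[symmetric]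
    by (simp add: vec_eq_iff diag_mat_mult diag_affine_def diag_mat_nth)
qed

section \<open>Propagation of the sum of phase angles\<close>

theorem theorem4p5:
  fixes V \<Psi>\<^sub>i :: "real^'n^'n"
    and E x\<^sub>i x\<^sub>f x :: real
    and \<phi> \<theta> :: "'n \<Rightarrow> real \<Rightarrow> real"
    and \<rho> \<tau> :: "'n \<Rightarrow> real"
  assumes V_diagonal: "\<And>j k. j \<noteq> k \<Longrightarrow> V $ j $ k = 0"
    and Psi_symmetric: "transpose \<Psi>\<^sub>i = \<Psi>\<^sub>i"
    and endpoints: "x\<^sub>f \<noteq> x\<^sub>i"
    and phi_continuous: "\<And>j. continuous_on (closed_segment x\<^sub>i x\<^sub>f) (\<phi> j)"
    and phi_angles: "\<And>y. y \<in> closed_segment x\<^sub>i x\<^sub>f \<Longrightarrow>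
          phase_angles (Psi_num V E \<Psi>\<^sub>i (y - x\<^sub>i)) (Psi_den V E \<Psi>\<^sub>i (y - x\<^sub>i)) (\<lambda>j. \<phi> j y)"
    and theta_initial: "\<And>j. \<theta> j x\<^sub>i = 0"
    and theta_ode: "\<And>j y. y \<in> closed_segment x\<^sub>i x\<^sub>f \<Longrightarrow>
          (\<theta> j has_real_derivative
             (cos (\<theta> j y))\<^sup>2 + (E *\<^sub>R mat 1 - V) $ j $ j * (sin (\<theta> j y))\<^sup>2)
          (at y within closed_segment x\<^sub>i x\<^sub>f)"
    and x_in: "x \<in> closed_segment x\<^sub>i x\<^sub>f"
    and rho_angles: "phase_angles (Psi_num V E \<Psi>\<^sub>i (x - x\<^sub>i)) (Psi_den V E \<Psi>\<^sub>i (x - x\<^sub>i)) \<rho>"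
    and rho_range: "\<And>j. 0 \<le> \<rho> j \<and> \<rho> j < pi"
    and tau_angles: "phase_angles (Psi_num V E \<Psi>\<^sub>i (x - x\<^sub>i)) (Omega_den V E \<Psi>\<^sub>i (x - x\<^sub>i)) \<tau>"
    and tau_range: "\<And>j. 0 \<le> \<tau> j \<and> \<tau> j < pi"
  shows "(\<Sum>j\<in>UNIV. \<phi> j x) =
         (\<Sum>j\<in>UNIV. \<phi> j x\<^sub>i) + (\<Sum>j\<in>UNIV. \<theta> j x) + (\<Sum>j\<in>UNIV. \<rho> j - \<tau> j)"
proof -
  let ?S = "closed_segment x\<^sub>i x\<^sub>f"
  define d where "d = (\<lambda>k. E - V $ k $ k)"
  define s c where "s = (\<lambda>y k. sol_sin (d k) (y - x\<^sub>i))" and "c = (\<lambda>y k. sol_cos (d k) (y - x\<^sub>i))"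
  define N where "N = (\<lambda>y. diag_affine (s y) (c y) \<Psi>\<^sub>i)"
  \<comment> \<open>\<open>Omega_den\<close> and \<open>Psi_den\<close> differ only in that the coefficient \<open>1\<close> of \<open>s\<close> becomes \<open>d\<close>:
    interpolate it linearly, keeping the numerator fixed.\<close>
  define e where "e = (\<lambda>\<sigma> k. (1 - \<sigma>) + \<sigma> * d k)"
  define M where "M = (\<lambda>y \<sigma>. diag_affine (c y) (\<lambda>k. - e \<sigma> k * s y k) \<Psi>\<^sub>i)"
  have N: "Psi_num V E \<Psi>\<^sub>i (y - x\<^sub>i) = N y" for y
    by (simp add: Psi_num_eq N_def s_def c_def d_def)
  have M1: "Psi_den V E \<Psi>\<^sub>i (y - x\<^sub>i) = M y 1" for y
    using V_diagonal by (simp add: Psi_den_eq M_def e_def s_def c_def d_def)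
  have M0: "Omega_den V E \<Psi>\<^sub>i (y - x\<^sub>i) = M y 0" for y
    by (simp add: Omega_den_eq M_def e_def s_def c_def d_def)
  have initial: "N x\<^sub>i = \<Psi>\<^sub>i" "M x\<^sub>i \<sigma> = mat 1" for \<sigma>
    by (simp_all add: N_def M_def s_def c_def diag_affine_def vec_eq_iff mat_def)
  have lag: "lagrangian_pair (N y) (M y \<sigma>)" if "\<sigma> \<in> {0..1}" for y \<sigma>
    unfolding N_def M_def
  proof (rule lagrangian_diag_affine[OF Psi_symmetric])
    fix k
    \<comment> \<open>The weight interpolates between c^2 + s^2 at \<sigma> = 0 and the energy 1 at
      \<sigma> = 1, both positive.\<close>
    have "(c y k)\<^sup>2 + e \<sigma> k * (s y k)\<^sup>2 = (1 - \<sigma>) * ((c y k)\<^sup>2 + (s y k)\<^sup>2) + \<sigma>"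
      using sol_energy[of "d k" "y - x\<^sub>i"] unfolding e_def s_def c_def by algebra
    also have "0 < \<dots>"
      using that sol_norm_pos[of "d k" "y - x\<^sub>i"] unfolding s_def c_def
      by (cases "\<sigma> = 1") (auto intro!: add_pos_nonneg)
    finally show "0 < (c y k)\<^sup>2 + e \<sigma> k * (s y k)\<^sup>2" .
  qed
  define F where "F = (\<lambda>(y, \<sigma>). pencil (N y) (M y \<sigma>) 1 \<i>)"
  have F0: "F (y, \<sigma>) \<noteq> 0" if "\<sigma> \<in> {0..1}" for y \<sigma>
    using pencil_nonzero[OF lag[OF that, of y], of 1] by (simp add: F_def)
  have "continuous_on (?S \<times> {0..1}) F"
    unfolding F_def case_prod_unfold N_def M_def s_def c_def e_def
    by (intro continuous_on_pencil continuous_on_diag_affine continuous_intros)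
  moreover have "contractible (?S \<times> {0..1::real})"
    by (intro convex_imp_contractible convex_Times) auto
  ultimately obtain g where g: "continuous_on (?S \<times> {0..1}) g" "\<And>p. p \<in> ?S \<times> {0..1} \<Longrightarrow> F p = exp (g p)"
    using continuous_logarithm_on_contractible[of "?S \<times> {0..1}" F] F0 by blast
  have gy: "continuous_on ?S (\<lambda>y. g (y, \<sigma>))" if "\<sigma> \<in> {0..1}" for \<sigma>
    by (rule continuous_on_compose2[OF g(1)]) (use that in \<open>auto intro!: continuous_intros\<close>)
  have gs: "continuous_on {0..1} (\<lambda>\<sigma>. g (y, \<sigma>))" if "y \<in> ?S" for y
    by (rule continuous_on_compose2[OF g(1)]) (use that in \<open>auto intro!: continuous_intros\<close>)
  \<comment> \<open>The change of argument along the deformation at fixed y. A logarithm on the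
    whole rectangle makes it continuous in y.\<close>
  define \<Lambda> where "\<Lambda> = (\<lambda>y. Im (g (y, 1)) - Im (g (y, 0)))"

  have shift: "\<Lambda> x = (\<Sum>j\<in>UNIV. \<rho> j - \<tau> j)"
    unfolding \<Lambda>_def
  proof (rule sum_phase_angles_shift[of "M x" "N x"])
    show "continuous_on {0..1} (\<lambda>\<sigma>. M x \<sigma> $ i $ j)" for i j
      unfolding M_def e_def by (intro continuous_on_diag_affine continuous_intros)
    show "exp (g (x, \<sigma>)) = pencil (N x) (M x \<sigma>) 1 \<i>" if "\<sigma> \<in> {0..1}" for \<sigma>
      using g(2)[of "(x, \<sigma>)"] that x_in by (simp add: F_def)
  qed (use lag gs[OF x_in] rho_angles rho_range tau_angles tau_range in \<open>simp_all add: N M0 M1\<close>)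

  have xi: "x\<^sub>i \<in> ?S" by simp
  \<comment> \<open>At the initial point all matrices of the deformation are the identity, so the
    argument does not change.\<close>
  have "g (x\<^sub>i, 1) = g (x\<^sub>i, 0)"
  proof (rule exp_const_imp_const[OF _ gs[OF xi]])
    show "exp (g (x\<^sub>i, \<sigma>)) = exp (g (x\<^sub>i, \<sigma>'))" if "\<sigma> \<in> {0..1}" "\<sigma>' \<in> {0..1}" for \<sigma> \<sigma>'
      using g(2)[of "(x\<^sub>i, \<sigma>)"] g(2)[of "(x\<^sub>i, \<sigma>')"] that by (simp add: F_def initial)
  qed auto
  hence \<Lambda>_init: "\<Lambda> x\<^sub>i = 0"
    by (simp add: \<Lambda>_def)

  let ?\<Sigma> = "\<lambda>\<psi> y. \<Sum>j\<in>(UNIV::'n set). \<psi> j y :: real"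
  let ?p = "pencil \<Psi>\<^sub>i (mat 1) 1 \<i>"
  \<comment> \<open>The factor 2 i makes exp (h y) depend on the angles modulo pi only, so it can be
    computed from determinants.\<close>
  define h where "h = (\<lambda>y. 2 * \<i> * of_real (?\<Sigma> \<phi> y - ?\<Sigma> \<theta> y - \<Lambda> y) :: complex)"
  have exp_\<theta>: "exp (2 * \<i> * of_real (?\<Sigma> \<theta> y))
      = (\<Prod>k\<in>UNIV. (of_real (c y k) + \<i> * of_real (s y k)) / (of_real (c y k) - \<i> * of_real (s y k)))"
    if y: "y \<in> ?S" for y
  proof -
    have "exp (2 * \<i> * of_real (\<theta> k y))
        = (of_real (c y k) + \<i> * of_real (s y k)) / (of_real (c y k) - \<i> * of_real (s y k))" for k
    proof -
      have eq: "sin (\<theta> k y) * c y k = cos (\<theta> k y) * s y k"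
        unfolding s_def c_def
        by (rule pruefer_angle[OF _ _ y]) (use theta_initial theta_ode in \<open>auto simp: d_def mat_def\<close>)
      show ?thesis
        using exp_twice_angle[OF eq] sol_norm_pos[of "d k" "y - x\<^sub>i"] by (simp add: s_def c_def)
    qed
    thus ?thesis
      by (simp only: of_real_sum sum_distrib_left exp_sum[OF finite])
  qed
  have exp_h: "exp (h y) = (-1) ^ CARD('n) * ?p / cnj ?p" if y: "y \<in> ?S" for y
  proof -
    define r where "r = (\<Prod>k\<in>UNIV. of_real (c y k) + \<i> * of_real (s y k) :: complex)"
    have F_0: "F (y, 0) = r * ?p"
      unfolding F_def N_def M_def e_def r_def using pencil_rotation[of "s y" "c y" \<Psi>\<^sub>i] by simp
    have r: "r \<noteq> 0"
      using F0[of 0 y] by (auto simp: F_0)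
    have 1: "exp (2 * \<i> * of_real (?\<Sigma> \<phi> y)) = (-1) ^ CARD('n) * F (y, 1) / cnj (F (y, 1))"
      using sum_phase_angles[of "N y" "M y 1" "\<lambda>j. \<phi> j y"] phi_angles[OF y] F0[of 1 y]
      by (simp add: F_def N M1)
    have 2: "exp (2 * \<i> * of_real (?\<Sigma> \<theta> y)) = r / cnj r"
      unfolding exp_\<theta>[OF y] r_def prod_dividef by simp
    have 3: "exp (2 * \<i> * of_real (\<Lambda> y)) = (F (y, 1) / cnj (F (y, 1))) / (F (y, 0) / cnj (F (y, 0)))"
      \<comment> \<open>Combined with the two preceding identities, F (y, 1) cancels against the
        \<phi> j and the rotation factor \<open>r\<close> in F (y, 0) against the \<theta> j. Only
        the pencil of the initial matrix, independent of y, is left.\<close>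
      using y unfolding \<Lambda>_def of_real_diff right_diff_distrib exp_diff exp_twice_Im by (simp add: g(2))
    have "exp (h y) = exp (2 * \<i> * of_real (?\<Sigma> \<phi> y)) / exp (2 * \<i> * of_real (?\<Sigma> \<theta> y)) / exp (2 * \<i> * of_real (\<Lambda> y))"
      unfolding h_def by (simp only: of_real_diff right_diff_distrib exp_diff)
    thus ?thesis
      unfolding 1 2 3 using r F0[of 1 y] F0[of 0 y] by (simp add: F_0)
  qed
  have "h x = h x\<^sub>i"
  proof (rule exp_const_imp_const[of ?S h])
    have "continuous_on ?S (\<theta> j)" for j
      using theta_ode by (rule DERIV_continuous_on)
    thus "continuous_on ?S h"
      unfolding h_def \<Lambda>_def by (intro continuous_intros phi_continuous gy) auto
  qed (use x_in in \<open>auto simp: exp_h\<close>)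
  hence "?\<Sigma> \<phi> x - ?\<Sigma> \<theta> x - \<Lambda> x = ?\<Sigma> \<phi> x\<^sub>i - ?\<Sigma> \<theta> x\<^sub>i - \<Lambda> x\<^sub>i"
    unfolding h_def by (metis mult_cancel_left of_real_eq_iff complex_i_not_zero mult_eq_0_iff zero_neq_numeral)
  thus ?thesis
    by (simp add: \<Lambda>_init shift theta_initial)
qed

end
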